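(* Let $\mathbb{F}$ be an infinite field with $\operatorname{char}(\mathbb{F}) \neq 2$, let $n \geq 3$, let $1 \leq k \leq n-1$, and let $T: \operatorname{Mat}_{n}(\mathbb{F}) \to \operatorname{Mat}_{n}(\mathbb{F})$ be a linear bijective map. Then $T(\Lambda^{k}) \subseteq \Lambda^{k}$ if and only if there exist permutations $\sigma_1, \sigma_2 \in S_n$ and diagonal matrices $D_1, D_2 \in \operatorname{Mat}_n(\mathbb{F})$ with nonzero diagonal elements such that either $T(A) = D_1 P(\sigma_1) A P(\sigma_2) D_2$ for all $A \in \operatorname{Mat}_n(\mathbb{F})$, or $T(A) = D_1 P(\sigma_1) A^T P(\sigma_2) D_2$ for all $A \in \operatorname{Mat}_n(\mathbb{F})$.
   Context: $\operatorname{Mat}_n(\mathbb{F})$ is the space of $n\times n$ matrices over $\mathbb{F}$. The permanental rank $\operatorname{prk}(A)$ of $A$ is the size of the largest square submatrix of $A$ with nonzero permanent (it is $0$ for the zero matrix). $\Lambda^{k} = \{A \in \operatorname{Mat}_n(\mathbb{F}) : \operatorname{prk}(A) = k\}$. For $\sigma \in S_n$, $P(\sigma) = (p_{ij})$ is the permutation matrix with $p_{ij} = 1$ if $j = \sigma^{-1}(i)$ and $p_{ij}=0$ otherwise. *)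

theory Defs
  imports "Jordan_Normal_Form.Matrix" "Jordan_Normal_Form.DL_Submatrix"
    "HOL-Combinatorics.Permutations"
begin

definition permanent :: "'a :: comm_ring_1 mat \<Rightarrow> 'a" where
  "permanent A = (\<Sum>p \<in> {p. p permutes {0..<dim_row A}}. \<Prod>i = 0..<dim_row A. A $$ (i, p i))"

text \<open>The empty submatrix has permanent 1, so the set below always contains 0.\<close>

definition prk :: "'a :: comm_ring_1 mat \<Rightarrow> nat" where
  "prk A = Max {m. \<exists>I J. I \<subseteq> {0..<dim_row A} \<and> J \<subseteq> {0..<dim_col A} \<and>
                       card I = m \<and> card J = m \<and> permanent (submatrix A I J) \<noteq> 0}"

definition prk_set :: "nat \<Rightarrow> nat \<Rightarrow> 'a :: comm_ring_1 mat set" where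
  "prk_set n k = {A \<in> carrier_mat n n. prk A = k}"

definition perm_matrix :: "nat \<Rightarrow> (nat \<Rightarrow> nat) \<Rightarrow> 'a :: zero_neq_one mat" where
  "perm_matrix n \<sigma> = mat n n (\<lambda>(i, j). if j = inv_into UNIV \<sigma> i then 1 else 0)"

definition linear_mat_map :: "nat \<Rightarrow> ('a :: comm_ring_1 mat \<Rightarrow> 'a mat) \<Rightarrow> bool" where
  "linear_mat_map n T \<longleftrightarrow>
     T \<in> carrier_mat n n \<rightarrow> carrier_mat n n \<and>
     (\<forall>A \<in> carrier_mat n n. \<forall>B \<in> carrier_mat n n. T (A + B) = T A + T B) \<and>
     (\<forall>c. \<forall>A \<in> carrier_mat n n. T (c \<cdot>\<^sub>m A) = c \<cdot>\<^sub>m T A)"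

lemma prk_zero_mat: "prk (0\<^sub>m n n :: 'a :: field mat) = 0"
proof -
  have "{m. \<exists>I J. I \<subseteq> {0..<n} \<and> J \<subseteq> {0..<n} \<and> card I = m \<and> card J = m \<and>
          permanent (submatrix (0\<^sub>m n n :: 'a mat) I J) \<noteq> 0} = {0}" (is "?S = _")
  proof (intro equalityI subsetI)
    fix m assume "m \<in> ?S"
    then obtain I J where IJ: "I \<subseteq> {0..<n}" "J \<subseteq> {0..<n}" "card I = m" "card J = m"
      and nz: "permanent (submatrix (0\<^sub>m n n :: 'a mat) I J) \<noteq> 0" by blast
    let ?B = "submatrix (0\<^sub>m n n :: 'a mat) I J"
    have eq: "{i. i < n \<and> i \<in> I} = I" "{i. i < n \<and> i \<in> J} = J" using IJ by auto
    have dims: "dim_row ?B = m" "dim_col ?B = m"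
      using IJ by (simp_all add: dim_submatrix eq)
    have "permanent ?B = 0" if "0 < m"
      unfolding permanent_def dims
    proof (rule sum.neutral, intro ballI)
      fix p assume "p \<in> {p. p permutes {0..<m}}"
      then have "p 0 < m" using that permutes_in_image[of p "{0..<m}" 0] by simp
      then have "?B $$ (0, p 0) = 0\<^sub>m n n $$ (pick I 0, pick J (p 0))"
        using that IJ by (simp add: submatrix_index eq)
      moreover have "pick I 0 < n" "pick J (p 0) < n"
        using pick_in_set_le[of 0 I] pick_in_set_le[of "p 0" J] that IJ \<open>p 0 < m\<close> by auto
      ultimately show "(\<Prod>i = 0..<m. ?B $$ (i, p i)) = 0"
        using that by (intro prod_zero) (auto intro!: bexI[of _ 0])
    qed
    with nz show "m \<in> {0}" by auto
  next
    fix m :: nat assume "m \<in> {0}"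
    then show "m \<in> ?S"
      by (auto simp: permanent_def dim_submatrix intro!: exI[of _ "{}"])
  qed
  then show ?thesis by (simp add: prk_def)
qed

end

theory Submission
  imports Defs "HOL-Computational_Algebra.Polynomial"
begin

text \<open>
  Adding a multiple \<open>x E\<close> of a suitable matrix unit raises the permanental rank by one for all but
  one \<open>x\<close>; since subpermanents are polynomial in \<open>x\<close> and the field is infinite, preserving rank
  equal to \<open>k\<close> implies preserving rank at most \<open>k\<close>. If rank at most \<open>k + 1\<close> is preserved and \<open>A\<close>
  has rank at most \<open>k\<close>, then \<open>A + y E\<close> has rank at most \<open>k + 1\<close> for every matrix unit \<open>E\<close>, so the
  derivatives at \<open>T A\<close> of all \<open>(k + 2)\<close>-subpermanents vanish in the directions \<open>T E\<close>, hence in all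
  directions; these derivatives include all \<open>(k + 1)\<close>-subpermanents of \<open>T A\<close>. Descending, \<open>T\<close>
  preserves rank at most 1.

  In characteristic other than 2 a linear space of matrices of permanental rank at most 1 that has
  dimension at least 3 lies in a single row or column. So \<open>T\<close> maps rows and columns into lines, and
  since the images must cover all positions, it maps matrix units to multiples of matrix units, up to
  transposition by permuting rows and columns. The coefficients have rank one because
  zero-permanent \<open>2 \<times> 2\<close> blocks go to zero-permanent blocks.
\<close>

section \<open>Subpermanents and their derivatives\<close>

text \<open>Extensionality fixes the values outside \<open>I\<close>, so each bijection is counted
  once and the sum in \<open>per\<close> is finite for finite index sets.\<close>

definition bijs :: "'b set \<Rightarrow> 'c set \<Rightarrow> ('b \<Rightarrow> 'c) set" where
  "bijs I J = {f \<in> extensional I. bij_betw f I J}"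

text \<open>The permanent of the submatrix on rows \<open>I\<close> and columns \<open>J\<close>. A
  permanent ignores the order of rows and columns, so plain index sets suffice, and deleting an
  index needs no renumbering.\<close>

definition per :: "('b \<Rightarrow> 'c \<Rightarrow> 'a :: comm_ring_1) \<Rightarrow> 'b set \<Rightarrow> 'c set \<Rightarrow> 'a" where
  "per a I J = (\<Sum>f\<in>bijs I J. \<Prod>i\<in>I. a i (f i))"

lemma finite_bijs:
  assumes "finite I" "finite J"
  shows "finite (bijs I J)"
proof (rule finite_subset)
  show "bijs I J \<subseteq> PiE I (\<lambda>_. J)"
    by (auto simp: bijs_def PiE_def bij_betw_def)
  show "finite (PiE I (\<lambda>_. J))"
    using assms by (intro finite_PiE) auto
qed

lemma per_cong:
  assumes "\<And>i j. i \<in> I \<Longrightarrow> j \<in> J \<Longrightarrow> a i j = b i j"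
  shows "per a I J = per b I J"
  unfolding per_def
  by (intro sum.cong prod.cong refl assms) (auto simp: bijs_def bij_betw_def)

lemma per_empty:
  fixes a :: "'b \<Rightarrow> 'c \<Rightarrow> 'a :: comm_ring_1"
  shows "per a {} {} = 1"
proof -
  have "bijs {} {} = {(\<lambda>x. undefined) :: 'b \<Rightarrow> 'c}"
    by (auto simp: bijs_def bij_betw_def)
  then show ?thesis by (simp add: per_def)
qed

text \<open>Relabeling sends a bijection \<open>f\<close> to \<open>\<beta>\<close> after
  \<open>f\<close> after the inverse of \<open>\<alpha>\<close>, with the same product. It serves
  both to undo the numbering in submatrices and to handle permuted rows and columns.\<close>

lemma per_reindex:
  assumes \<alpha>: "inj_on \<alpha> I" and \<beta>: "inj_on \<beta> J"
  shows "per (\<lambda>i j. a (\<alpha> i) (\<beta> j)) I J = per a (\<alpha> ` I) (\<beta> ` J)"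
  unfolding per_def
proof (rule sum.reindex_bij_witness[where
      i = "\<lambda>g. restrict (\<lambda>i. inv_into J \<beta> (g (\<alpha> i))) I" and
      j = "\<lambda>f. restrict (\<lambda>x. \<beta> (f (inv_into I \<alpha> x))) (\<alpha> ` I)"])
  fix f assume f: "f \<in> bijs I J"
  then have fJ: "\<And>i. i \<in> I \<Longrightarrow> f i \<in> J" by (auto simp: bijs_def bij_betw_def)
  show "restrict (\<lambda>i. inv_into J \<beta> (restrict (\<lambda>x. \<beta> (f (inv_into I \<alpha> x))) (\<alpha> ` I) (\<alpha> i))) I = f"
    using f \<alpha> \<beta> fJ by (intro ext) (auto simp: bijs_def restrict_def extensional_def)
  have "bij_betw (\<lambda>x. \<beta> (f (inv_into I \<alpha> x))) (\<alpha> ` I) (\<beta> ` J)"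
  proof -
    have 1: "bij_betw (inv_into I \<alpha>) (\<alpha> ` I) I"
      using \<alpha> by (simp add: bij_betw_inv_into inj_on_imp_bij_betw)
    have 2: "bij_betw f I J" using f by (simp add: bijs_def)
    have 3: "bij_betw \<beta> J (\<beta> ` J)" using \<beta> by (simp add: inj_on_imp_bij_betw)
    show ?thesis using bij_betw_trans[OF bij_betw_trans[OF 1 2] 3] by (simp add: o_def)
  qed
  then show "restrict (\<lambda>x. \<beta> (f (inv_into I \<alpha> x))) (\<alpha> ` I) \<in> bijs (\<alpha> ` I) (\<beta> ` J)"
    by (simp add: bijs_def)
  show "(\<Prod>x\<in>\<alpha> ` I. a x (restrict (\<lambda>x. \<beta> (f (inv_into I \<alpha> x))) (\<alpha> ` I) x)) =
      (\<Prod>i\<in>I. a (\<alpha> i) (\<beta> (f i)))"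
    using \<alpha> by (simp add: prod.reindex)
next
  fix g assume g: "g \<in> bijs (\<alpha> ` I) (\<beta> ` J)"
  then have gJ: "\<And>i. i \<in> I \<Longrightarrow> g (\<alpha> i) \<in> \<beta> ` J" by (auto simp: bijs_def bij_betw_def)
  have "bij_betw (\<lambda>i. inv_into J \<beta> (g (\<alpha> i))) I J"
  proof -
    have 1: "bij_betw \<alpha> I (\<alpha> ` I)" using \<alpha> by (simp add: inj_on_imp_bij_betw)
    have 2: "bij_betw g (\<alpha> ` I) (\<beta> ` J)" using g by (simp add: bijs_def)
    have 3: "bij_betw (inv_into J \<beta>) (\<beta> ` J) J"
      using \<beta> by (simp add: bij_betw_inv_into inj_on_imp_bij_betw)
    show ?thesis using bij_betw_trans[OF bij_betw_trans[OF 1 2] 3] by (simp add: o_def)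
  qed
  then show "restrict (\<lambda>i. inv_into J \<beta> (g (\<alpha> i))) I \<in> bijs I J"
    by (simp add: bijs_def)
  show "restrict (\<lambda>x. \<beta> (restrict (\<lambda>i. inv_into J \<beta> (g (\<alpha> i))) I (inv_into I \<alpha> x))) (\<alpha> ` I) = g"
    using g \<alpha> gJ by (intro ext) (auto simp: bijs_def restrict_def extensional_def f_inv_into_f)
qed

text \<open>A bijection and its inverse run through the same entries.\<close>

lemma per_transpose:
  "per (\<lambda>i j. a j i) I J = per a J I"
  unfolding per_def
proof (rule sum.reindex_bij_witness[where
      i = "\<lambda>g. restrict (inv_into J g) I" and j = "\<lambda>f. restrict (inv_into I f) J"])
  fix f assume f: "f \<in> bijs I J"
  then have b: "bij_betw f I J" by (simp add: bijs_def)
  then have inj: "inj_on f I" and im: "f ` I = J" by (auto simp: bij_betw_def)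
  have bi: "bij_betw (restrict (inv_into I f) J) J I"
    using bij_betw_inv_into[OF b] by simp
  show "restrict (inv_into J (restrict (inv_into I f) J)) I = f"
  proof
    fix x
    show "restrict (inv_into J (restrict (inv_into I f) J)) I x = f x"
    proof (cases "x \<in> I")
      case True
      have "f x \<in> J" using True im by auto
      then have "inv_into J (restrict (inv_into I f) J) x = f x"
        using True bi inj by (intro inv_into_f_eq) (auto simp: bij_betw_def)
      then show ?thesis using True by simp
    qed (use f in \<open>auto simp: bijs_def extensional_def\<close>)
  qed
  show "restrict (inv_into I f) J \<in> bijs J I"
    using bi by (simp add: bijs_def)
  show "(\<Prod>j\<in>J. a j (restrict (inv_into I f) J j)) = (\<Prod>i\<in>I. a (f i) i)"
    using inj by (simp add: im[symmetric] prod.reindex)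
next
  fix g assume g: "g \<in> bijs J I"
  then have b: "bij_betw g J I" by (simp add: bijs_def)
  then have inj: "inj_on g J" and im: "g ` J = I" by (auto simp: bij_betw_def)
  have bi: "bij_betw (restrict (inv_into J g) I) I J"
    using bij_betw_inv_into[OF b] by simp
  show "restrict (inv_into I (restrict (inv_into J g) I)) J = g"
  proof
    fix x
    show "restrict (inv_into I (restrict (inv_into J g) I)) J x = g x"
    proof (cases "x \<in> J")
      case True
      have "g x \<in> I" using True im by auto
      then have "inv_into I (restrict (inv_into J g) I) x = g x"
        using True bi inj by (intro inv_into_f_eq) (auto simp: bij_betw_def)
      then show ?thesis using True by simp
    qed (use g in \<open>auto simp: bijs_def extensional_def\<close>)
  qed
  show "restrict (inv_into J g) I \<in> bijs I J"
    using bi by (simp add: bijs_def)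
qed

text \<open>Each bijection meets every row and every column of the block exactly once, so all
  summands acquire the same factor.\<close>

lemma per_scale:
  assumes "finite I" "finite J"
  shows "per (\<lambda>i j. d i * e j * a i j) I J = prod d I * prod e J * per a I J"
proof -
  have "(\<Prod>i\<in>I. d i * e (f i) * a i (f i)) = prod d I * prod e J * (\<Prod>i\<in>I. a i (f i))"
    if "f \<in> bijs I J" for f
  proof -
    have "(\<Prod>i\<in>I. e (f i)) = prod e J"
      using that prod.reindex_bij_betw[of f I J e] by (simp add: bijs_def)
    then show ?thesis by (simp add: prod.distrib)
  qed
  then show ?thesis by (simp add: per_def sum_distrib_left)
qed

text \<open>Restriction to \<open>I - {i0}\<close> is inverse to extension by the value
  \<open>j0\<close> at \<open>i0\<close>. Laplace expansion, \<open>dper_unit\<close> and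
  \<open>per_add_unit\<close> all rest on this.\<close>

lemma sum_bijs_fixed:
  assumes "i0 \<in> I" "j0 \<in> J"
  shows "(\<Sum>f | f \<in> bijs I J \<and> f i0 = j0. \<Prod>i\<in>I - {i0}. a i (f i)) = per a (I - {i0}) (J - {j0})"
  unfolding per_def
proof (rule sum.reindex_bij_witness[where
      i = "\<lambda>g. g(i0 := j0)" and j = "\<lambda>f. restrict f (I - {i0})"])
  fix f assume f: "f \<in> {f. f \<in> bijs I J \<and> f i0 = j0}"
  show "(restrict f (I - {i0}))(i0 := j0) = f"
    using f by (intro ext) (auto simp: bijs_def extensional_def)
  have "bij_betw f (I - {i0}) (J - {j0})"
    using f assms by (auto simp: bijs_def bij_betw_def inj_on_def)
  then show "restrict f (I - {i0}) \<in> bijs (I - {i0}) (J - {j0})"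
    by (simp add: bijs_def)
  show "(\<Prod>i\<in>I - {i0}. a i (restrict f (I - {i0}) i)) = (\<Prod>i\<in>I - {i0}. a i (f i))"
    by (rule prod.cong) auto
next
  fix g assume g: "g \<in> bijs (I - {i0}) (J - {j0})"
  show "restrict (g(i0 := j0)) (I - {i0}) = g"
    using g by (intro ext) (auto simp: bijs_def extensional_def restrict_def)
  have b: "bij_betw g (I - {i0}) (J - {j0})" using g by (simp add: bijs_def)
  have "bij_betw (g(i0 := j0)) (I - {i0}) (J - {j0})"
    using b by (subst bij_betw_cong[of _ _ g]) auto
  then have "bij_betw (g(i0 := j0)) ((I - {i0}) \<union> {i0}) ((J - {j0}) \<union> {j0})"
    by (intro bij_betw_combine) auto
  moreover have "(I - {i0}) \<union> {i0} = I" "(J - {j0}) \<union> {j0} = J" using assms by auto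
  ultimately show "g(i0 := j0) \<in> {f. f \<in> bijs I J \<and> f i0 = j0}"
    using g assms by (auto simp: bijs_def extensional_def)
qed

text \<open>The bijections are grouped by their value at \<open>i0\<close>.\<close>

lemma per_laplace:
  assumes fin: "finite I" "finite J" and i0: "i0 \<in> I"
  shows "per a I J = (\<Sum>j\<in>J. a i0 j * per a (I - {i0}) (J - {j}))"
proof -
  have "per a I J = (\<Sum>j\<in>J. \<Sum>f | f \<in> bijs I J \<and> f i0 = j. \<Prod>i\<in>I. a i (f i))"
    unfolding per_def
    by (rule sum.group[symmetric, OF finite_bijs[OF fin] fin(2)])
      (use i0 in \<open>auto simp: bijs_def bij_betw_def\<close>)
  also have "\<dots> = (\<Sum>j\<in>J. a i0 j * (\<Sum>f | f \<in> bijs I J \<and> f i0 = j. \<Prod>i\<in>I - {i0}. a i (f i)))"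
    unfolding sum_distrib_left
    by (intro sum.cong refl) (auto simp: prod.remove[OF fin(1) i0])
  also have "\<dots> = (\<Sum>j\<in>J. a i0 j * per a (I - {i0}) (J - {j}))"
    by (intro sum.cong refl) (simp add: sum_bijs_fixed[OF i0])
  finally show ?thesis .
qed

lemma per_two:
  assumes "i \<noteq> i'" "j \<noteq> j'"
  shows "per a {i, i'} {j, j'} = a i j * a i' j' + a i j' * a i' j"
proof -
  have single: "per a {x} {y} = a x y" for x y
    by (subst per_laplace[of _ _ x]) (simp_all add: per_empty)
  have "{i, i'} - {i} = {i'}" "{j, j'} - {j} = {j'}" "{j, j'} - {j'} = {j}"
    using assms by auto
  then show ?thesis
    using assms by (subst per_laplace[of _ _ i]) (simp_all add: single)
qed

text \<open>The derivative of the subpermanent at \<open>a\<close> in the direction \<open>b\<close>.\<close>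

definition dper :: "('b \<Rightarrow> 'c \<Rightarrow> 'a :: comm_ring_1) \<Rightarrow> ('b \<Rightarrow> 'c \<Rightarrow> 'a) \<Rightarrow> 'b set \<Rightarrow> 'c set \<Rightarrow> 'a" where
  "dper a b I J = (\<Sum>f\<in>bijs I J. \<Sum>i\<in>I. b i (f i) * (\<Prod>i'\<in>I - {i}. a i' (f i')))"

lemma dper_cong:
  assumes "\<And>i j. i \<in> I \<Longrightarrow> j \<in> J \<Longrightarrow> b i j = b' i j"
  shows "dper a b I J = dper a b' I J"
  unfolding dper_def
  by (intro sum.cong refl arg_cong2[of _ _ _ _ "(*)"] assms) (auto simp: bijs_def dest: bij_betwE)

lemma dper_scale: "dper a (\<lambda>i j. c * b i j) I J = c * dper a b I J"
  by (simp add: dper_def sum_distrib_left mult.assoc)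

lemma dper_sum: "dper a (\<lambda>i j. \<Sum>x\<in>S. b x i j) I J = (\<Sum>x\<in>S. dper a (b x) I J)"
proof -
  have "dper a (\<lambda>i j. \<Sum>x\<in>S. b x i j) I J =
      (\<Sum>f\<in>bijs I J. \<Sum>x\<in>S. \<Sum>i\<in>I. b x i (f i) * (\<Prod>i'\<in>I - {i}. a i' (f i')))"
    unfolding dper_def sum_distrib_right by (intro sum.cong refl sum.swap)
  also have "\<dots> = (\<Sum>x\<in>S. dper a (b x) I J)"
    unfolding dper_def by (rule sum.swap)
  finally show ?thesis .
qed

definition unit_fun :: "'b \<Rightarrow> 'c \<Rightarrow> 'b \<Rightarrow> 'c \<Rightarrow> 'a :: comm_ring_1" where
  "unit_fun i j = (\<lambda>i' j'. if i' = i \<and> j' = j then 1 else 0)"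

text \<open>Only the summands with \<open>i = i0\<close> and \<open>f i0 = j0\<close> survive.
  Smaller subpermanents thus are derivatives of larger ones, which lets the preserved rank bound be
  lowered.\<close>

lemma dper_unit:
  assumes "finite I" "finite J" "i0 \<in> I" "j0 \<in> J"
  shows "dper a (unit_fun i0 j0) I J = per a (I - {i0}) (J - {j0})"
proof -
  have "(\<Sum>i\<in>I. unit_fun i0 j0 i (f i) * (\<Prod>i'\<in>I - {i}. a i' (f i'))) =
      (if f i0 = j0 then \<Prod>i'\<in>I - {i0}. a i' (f i') else 0)" for f
  proof -
    have "(\<Sum>i\<in>I. unit_fun i0 j0 i (f i) * (\<Prod>i'\<in>I - {i}. a i' (f i'))) =
      (\<Sum>i\<in>I. if i = i0 then (if f i0 = j0 then \<Prod>i'\<in>I - {i0}. a i' (f i') else 0) else 0)"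
      by (intro sum.cong refl) (auto simp: unit_fun_def)
    then show ?thesis using assms by simp
  qed
  then have "dper a (unit_fun i0 j0) I J =
      (\<Sum>f\<in>bijs I J. if f i0 = j0 then \<Prod>i'\<in>I - {i0}. a i' (f i') else 0)"
    by (simp add: dper_def)
  also have "\<dots> = (\<Sum>f | f \<in> bijs I J \<and> f i0 = j0. \<Prod>i'\<in>I - {i0}. a i' (f i'))"
    using assms by (simp add: sum.inter_filter[symmetric] finite_bijs)
  finally show ?thesis using assms by (simp add: sum_bijs_fixed)
qed

text \<open>A permanent is affine in each single entry, with the complementary subpermanent as
  slope.\<close>

lemma per_add_unit:
  assumes fin: "finite I" "finite J" and ij: "i0 \<in> I" "j0 \<in> J"
  shows "per (\<lambda>i j. a i j + x * unit_fun i0 j0 i j) I J =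
    per a I J + x * per a (I - {i0}) (J - {j0})"
proof -
  have "(\<Prod>i\<in>I. a i (f i) + x * unit_fun i0 j0 i (f i)) =
      (\<Prod>i\<in>I. a i (f i)) + x * (if f i0 = j0 then \<Prod>i\<in>I - {i0}. a i (f i) else 0)" for f
  proof -
    have "(\<Prod>i\<in>I - {i0}. a i (f i) + x * unit_fun i0 j0 i (f i)) = (\<Prod>i\<in>I - {i0}. a i (f i))"
      by (intro prod.cong) (auto simp: unit_fun_def)
    then show ?thesis
      by (simp add: prod.remove[OF fin(1) ij(1)] unit_fun_def algebra_simps)
  qed
  then have "per (\<lambda>i j. a i j + x * unit_fun i0 j0 i j) I J =
    per a I J + x * (\<Sum>f\<in>bijs I J. if f i0 = j0 then \<Prod>i\<in>I - {i0}. a i (f i) else 0)"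
    by (simp add: per_def sum.distrib sum_distrib_left)
  also have "(\<Sum>f\<in>bijs I J. if f i0 = j0 then \<Prod>i\<in>I - {i0}. a i (f i) else 0) =
     (\<Sum>f | f \<in> bijs I J \<and> f i0 = j0. \<Prod>i'\<in>I - {i0}. a i' (f i'))"
    using assms by (simp add: sum.inter_filter[symmetric] finite_bijs)
  finally show ?thesis using assms by (simp add: sum_bijs_fixed)
qed

lemma per_add_unit_outside:
  assumes "\<not> (i0 \<in> I \<and> j0 \<in> J)"
  shows "per (\<lambda>i j. a i j + x * unit_fun i0 j0 i j) I J = per a I J"
  using assms by (intro per_cong) (auto simp: unit_fun_def)

text \<open>Placing a linear polynomial at each entry gives a polynomial whose values are the
  subpermanents along the line; the product rule turns its derivative at 0 into
  \<open>dper\<close>.\<close>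

lemma per_line_poly:
  fixes a b :: "'b \<Rightarrow> 'c \<Rightarrow> 'a :: idom"
  shows "\<exists>p. (\<forall>y. poly p y = per (\<lambda>i j. a i j + y * b i j) I J) \<and>
    poly (pderiv p) 0 = dper a b I J"
proof (intro exI conjI allI)
  define p where "p = (\<Sum>f\<in>bijs I J. \<Prod>i\<in>I. [:a i (f i), b i (f i):])"
  show "poly p y = per (\<lambda>i j. a i j + y * b i j) I J" for y
    by (simp add: p_def per_def poly_sum poly_prod)
  show "poly (pderiv p) 0 = dper a b I J"
    \<comment> \<open>The first-order instance of \<open>higher_pderiv_sum\<close> says that
      differentiation commutes with finite sums.\<close>
    by (simp add: p_def dper_def higher_pderiv_sum[of 1, simplified] poly_sum poly_prod pderiv_prod pderiv_pCons mult.commute)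
qed

text \<open>The finite set \<open>S\<close> leaves room for the one parameter value at which a
  perturbation may fail to raise the rank.\<close>

lemma poly_zero_if_cofinite_roots:
  fixes p :: "'a :: idom poly"
  assumes "infinite (UNIV :: 'a set)" "finite S" "\<And>x. x \<notin> S \<Longrightarrow> poly p x = 0"
  shows "p = 0"
proof (rule ccontr)
  assume "p \<noteq> 0"
  then have "finite {x. poly p x = 0}" by (rule poly_roots_finite)
  then have "finite (S \<union> {x. poly p x = 0})" using assms by simp
  moreover have "S \<union> {x. poly p x = 0} = UNIV" using assms(3) by auto
  ultimately show False using assms(1) by simp
qed

text \<open>By Laplace expansion all larger subpermanents vanish too, so this is permanental rank at
  most \<open>k\<close> on indices below \<open>n\<close>.\<close>

definition vanish :: "nat \<Rightarrow> nat \<Rightarrow> (nat \<Rightarrow> nat \<Rightarrow> 'a :: comm_ring_1) \<Rightarrow> bool" where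
  "vanish n k a \<longleftrightarrow> (\<forall>I \<subseteq> {0..<n}. \<forall>J \<subseteq> {0..<n}. card I = Suc k \<longrightarrow> card J = Suc k \<longrightarrow> per a I J = 0)"

lemma vanish_Suc:
  assumes "vanish n k a"
  shows "vanish n (Suc k) a"
  unfolding vanish_def
proof (intro allI impI)
  fix I J assume I: "I \<subseteq> {0..<n}" "card I = Suc (Suc k)" and J: "J \<subseteq> {0..<n}" "card J = Suc (Suc k)"
  have fin: "finite I" "finite J" using I J by (auto intro: finite_subset)
  obtain i0 where "i0 \<in> I" using I by fastforce
  have "per a (I - {i0}) (J - {j}) = 0" if "j \<in> J" for j
  proof -
    have "I - {i0} \<subseteq> {0..<n}" "J - {j} \<subseteq> {0..<n}" using I J by auto
    moreover have "card (I - {i0}) = Suc k" "card (J - {j}) = Suc k"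
      using \<open>i0 \<in> I\<close> that I J by simp_all
    ultimately show ?thesis using assms unfolding vanish_def by blast
  qed
  then show "per a I J = 0"
    by (simp add: per_laplace[OF fin \<open>i0 \<in> I\<close>])
qed

lemma vanish_mono:
  assumes "vanish n k a" "k \<le> k'"
  shows "vanish n k' a"
  using assms(2,1) by (induction rule: dec_induct) (auto intro: vanish_Suc)

section \<open>Comparison with permanents of submatrices and with the permanental rank\<close>

lemma permanent_conv_per:
  assumes "B \<in> carrier_mat m m"
  shows "permanent B = per (\<lambda>i j. B $$ (i, j)) {0..<m} {0..<m}"
proof -
  have "permanent B = (\<Sum>p | p permutes {0..<m}. \<Prod>i = 0..<m. B $$ (i, p i))"
    using assms by (simp add: permanent_def)
  also have "\<dots> = per (\<lambda>i j. B $$ (i, j)) {0..<m} {0..<m}"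
    unfolding per_def
  \<comment> \<open>Outside \<open>{0..<m}\<close> a permutation is the identity, whereas a member
    of \<open>bijs\<close> is \<open>undefined\<close>; the two maps exchange these
    conventions.\<close>
  proof (rule sum.reindex_bij_witness[where
        i = "\<lambda>f x. if x \<in> {0..<m} then f x else x" and j = "\<lambda>p. restrict p {0..<m}"])
    fix p assume p: "p \<in> {p. p permutes {0..<m}}"
    show "(\<lambda>x. if x \<in> {0..<m} then restrict p {0..<m} x else x) = p"
      using p by (auto simp: permutes_def fun_eq_iff)
    show "restrict p {0..<m} \<in> bijs {0..<m} {0..<m}"
      using p by (simp add: bijs_def permutes_imp_bij)
    show "(\<Prod>i = 0..<m. B $$ (i, restrict p {0..<m} i)) = (\<Prod>i = 0..<m. B $$ (i, p i))"
      by (rule prod.cong) auto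
  next
    fix f assume f: "f \<in> bijs {0..<m} {0..<m}"
    show "restrict (\<lambda>x. if x \<in> {0..<m} then f x else x) {0..<m} = f"
      using f by (auto simp: bijs_def extensional_def fun_eq_iff)
    have "bij_betw (\<lambda>x. if x \<in> {0..<m} then f x else x) {0..<m} {0..<m}"
      using f by (subst bij_betw_cong[of _ _ f]) (auto simp: bijs_def)
    then show "(\<lambda>x. if x \<in> {0..<m} then f x else x) \<in> {p. p permutes {0..<m}}"
      by (auto intro: bij_imp_permutes)
  qed
  finally show ?thesis .
qed

text \<open>\<open>pick\<close> enumerates in increasing order, hence injectively; counting gives
  surjectivity.\<close>

lemma pick_image:
  assumes "finite I"
  shows "pick I ` {0..<card I} = I" "inj_on (pick I) {0..<card I}"
proof -
  show inj: "inj_on (pick I) {0..<card I}"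
    by (intro strict_mono_on_imp_inj_on strict_mono_onI) (auto intro: pick_mono_le)
  show "pick I ` {0..<card I} = I"
    using inj assms by (intro card_subset_eq) (auto simp: card_image pick_in_set_le)
qed

text \<open>Equal cardinalities make the submatrix square, as \<open>permanent\<close> reads its
  size off the rows; the numbering by \<open>pick\<close> is then undone by
  \<open>per_reindex\<close>.\<close>

lemma permanent_submatrix:
  assumes A: "A \<in> carrier_mat n n" and I: "I \<subseteq> {0..<n}" and J: "J \<subseteq> {0..<n}"
    and c: "card I = card J"
  shows "permanent (submatrix A I J) = per (\<lambda>i j. A $$ (i, j)) I J"
proof -
  have fin: "finite I" "finite J" using I J by (auto intro: finite_subset)
  have eq: "{i. i < n \<and> i \<in> I} = I" "{i. i < n \<and> i \<in> J} = J" using I J by auto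
  have "submatrix A I J \<in> carrier_mat (card I) (card I)"
    using A c by (intro carrier_matI) (simp_all add: dim_submatrix eq)
  then have "permanent (submatrix A I J) =
      per (\<lambda>i j. submatrix A I J $$ (i, j)) {0..<card I} {0..<card J}"
    using c by (simp add: permanent_conv_per)
  also have "\<dots> = per (\<lambda>i j. A $$ (pick I i, pick J j)) {0..<card I} {0..<card J}"
    using A by (intro per_cong) (simp add: submatrix_index eq)
  also have "\<dots> = per (\<lambda>i j. A $$ (i, j)) I J"
    using per_reindex[OF pick_image(2)[OF fin(1)] pick_image(2)[OF fin(2)], of "\<lambda>i j. A $$ (i, j)"]
    by (simp add: pick_image fin)
  finally show ?thesis .
qed

lemma prk_conv_per:
  assumes "A \<in> carrier_mat n n"
  shows "prk A = Max {m. \<exists>I J. I \<subseteq> {0..<n} \<and> J \<subseteq> {0..<n} \<and> card I = m \<and> card J = m \<and>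
           per (\<lambda>i j. A $$ (i, j)) I J \<noteq> 0}"
proof -
  have dims: "dim_row A = n" "dim_col A = n" using assms by auto
  show ?thesis
    unfolding prk_def dims
    by (intro arg_cong[of _ _ Max] Collect_cong arg_cong[of _ _ Ex] ext conj_cong refl)
      (simp add: permanent_submatrix[OF assms])
qed

lemma prk_le_iff_vanish:
  assumes "A \<in> carrier_mat n n"
  shows "prk A \<le> k \<longleftrightarrow> vanish n k (\<lambda>i j. A $$ (i, j))"
proof -
  let ?a = "\<lambda>i j. A $$ (i, j)"
  define S where "S = {m. \<exists>I J. I \<subseteq> {0..<n} \<and> J \<subseteq> {0..<n} \<and> card I = m \<and> card J = m \<and> per ?a I J \<noteq> 0}"
  have "S \<subseteq> {0..n}" by (auto simp: S_def) (metis card_mono card_atLeastLessThan diff_zero finite_atLeastLessThan)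
  then have fin: "finite S" by (rule finite_subset) simp
  \<comment> \<open>The empty subpermanent is 1, so the maximum is taken over a nonempty
    set.\<close>
  have "0 \<in> S" by (auto simp: S_def per_empty intro!: exI[of _ "{}"])
  then have "S \<noteq> {}" by blast
  then have "prk A \<le> k \<longleftrightarrow> (\<forall>m\<in>S. m \<le> k)"
    unfolding prk_conv_per[OF assms, folded S_def] by (rule Max_le_iff[OF fin])
  also have "\<dots> \<longleftrightarrow> vanish n k ?a"
  proof
    assume "\<forall>m\<in>S. m \<le> k"
    then have "Suc k \<notin> S" by (auto simp: not_less_eq_eq)
    then show "vanish n k ?a" unfolding S_def vanish_def by blast
  next
    assume v: "vanish n k ?a"
    show "\<forall>m\<in>S. m \<le> k"
    proof (intro ballI leI notI)
      fix m assume m: "m \<in> S" "k < m"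
      \<comment> \<open>As \<open>m\<close> is positive, \<open>vanish n (m - 1)\<close> is a
        statement about subpermanents of size \<open>m\<close>.\<close>
      then have "vanish n (m - 1) ?a" using v by (auto intro: vanish_mono)
      then show False using m by (auto simp: S_def vanish_def)
    qed
  qed
  finally show ?thesis .
qed

section \<open>Spaces of permanental rank at most 1\<close>

text \<open>The quadrics given by the 2 x 2 subpermanents, spelled out entrywise so that they can be
  polarized.\<close>

definition prk1 :: "nat \<Rightarrow> (nat \<Rightarrow> nat \<Rightarrow> 'a :: comm_ring_1) \<Rightarrow> bool" where
  "prk1 n a \<longleftrightarrow> (\<forall>i<n. \<forall>i'<n. \<forall>j<n. \<forall>j'<n. i \<noteq> i' \<longrightarrow> j \<noteq> j' \<longrightarrow>
     a i j * a i' j' + a i j' * a i' j = 0)"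

lemma prk1_transpose: "prk1 n a \<Longrightarrow> prk1 n (\<lambda>i j. a j i)"
  unfolding prk1_def by (metis mult.commute)

lemma vanish_1_iff_prk1: "vanish n 1 a \<longleftrightarrow> prk1 n a"
proof
  assume v: "vanish n 1 a"
  show "prk1 n a"
    unfolding prk1_def
  proof (intro allI impI)
    fix i i' j j' assume *: "i < n" "i' < n" "j < n" "j' < n" "i \<noteq> i'" "j \<noteq> j'"
    then have "per a {i, i'} {j, j'} = 0"
      using v unfolding vanish_def by (simp add: card_insert_if)
    then show "a i j * a i' j' + a i j' * a i' j = 0"
      using * by (simp add: per_two)
  qed
next
  assume p: "prk1 n a"
  show "vanish n 1 a"
    unfolding vanish_def
  proof (intro allI impI)
    fix I J assume *: "I \<subseteq> {0..<n}" "J \<subseteq> {0..<n}" "card I = Suc 1" "card J = Suc 1"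
    then obtain i i' j j' where "I = {i, i'}" "i \<noteq> i'" "J = {j, j'}" "j \<noteq> j'"
      by (metis One_nat_def Suc_1 card_2_iff)
    then show "per a I J = 0"
      using * p by (simp add: per_two prk1_def)
  qed
qed

text \<open>The assumption \<open>dim3\<close> stands for dimension at least 3: two coordinate functionals cannot
  separate the points.\<close>

locale prk1_space =
  fixes n :: nat and V :: "(nat \<Rightarrow> nat \<Rightarrow> 'a :: field) set"
  assumes infinite_field: "infinite (UNIV :: 'a set)"
    and two_neq_0: "(2 :: 'a) \<noteq> 0"
    and add: "X \<in> V \<Longrightarrow> Y \<in> V \<Longrightarrow> (\<lambda>i j. X i j + Y i j) \<in> V"
    and scale: "X \<in> V \<Longrightarrow> (\<lambda>i j. t * X i j) \<in> V"
    and prk1: "X \<in> V \<Longrightarrow> prk1 n X"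
    and dim3: "i < n \<Longrightarrow> j < n \<Longrightarrow> i' < n \<Longrightarrow> j' < n \<Longrightarrow>
      \<exists>Y\<in>V. Y i j = 0 \<and> Y i' j' = 0 \<and> (\<exists>r<n. \<exists>s<n. Y r s \<noteq> 0)"
begin

lemma quadric:
  assumes "X \<in> V" "i < n" "i' < n" "j < n" "j' < n" "i \<noteq> i'" "j \<noteq> j'"
  shows "X i j * X i' j' + X i j' * X i' j = 0"
  using prk1[OF assms(1)] assms(2-) unfolding prk1_def by blast

text \<open>Polarization: expand the quadric at \<open>X + Y\<close>, which lies in
  \<open>V\<close>, and subtract those at \<open>X\<close> and \<open>Y\<close>.\<close>

lemma polar:
  assumes X: "X \<in> V" and Y: "Y \<in> V" and ij: "i < n" "i' < n" "j < n" "j' < n" "i \<noteq> i'" "j \<noteq> j'"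
  shows "X i j * Y i' j' + X i' j' * Y i j + X i j' * Y i' j + X i' j * Y i j' = 0"
proof -
  have "X i j * Y i' j' + X i' j' * Y i j + X i j' * Y i' j + X i' j * Y i j' =
      ((X i j + Y i j) * (X i' j' + Y i' j') + (X i j' + Y i j') * (X i' j + Y i' j)) -
      (X i j * X i' j' + X i j' * X i' j) - (Y i j * Y i' j' + Y i j' * Y i' j)"
    by (simp add: algebra_simps)
  then show ?thesis
    using quadric[OF add[OF X Y] ij] quadric[OF X ij] quadric[OF Y ij] by simp
qed

text \<open>Through this symmetry, statements about rows yield statements about columns.\<close>

lemma transpose: "prk1_space n ((\<lambda>X i j. X j i) ` V)"
proof
  fix X Y assume "X \<in> (\<lambda>X i j. X j i) ` V" "Y \<in> (\<lambda>X i j. X j i) ` V"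
  then obtain X' Y' where *: "X' \<in> V" "Y' \<in> V" "X = (\<lambda>i j. X' j i)" "Y = (\<lambda>i j. Y' j i)" by auto
  show "(\<lambda>i j. X i j + Y i j) \<in> (\<lambda>X i j. X j i) ` V"
    unfolding * by (rule image_eqI[OF _ add[OF *(1,2)]]) simp
next
  fix X t assume "X \<in> (\<lambda>X i j. X j i) ` V"
  then obtain X' where *: "X' \<in> V" "X = (\<lambda>i j. X' j i)" by auto
  show "(\<lambda>i j. t * X i j) \<in> (\<lambda>X i j. X j i) ` V"
    unfolding * by (rule image_eqI[OF _ scale[OF *(1)]]) simp
next
  fix X assume "X \<in> (\<lambda>X i j. X j i) ` V"
  then show "prk1 n X" by (auto intro: prk1_transpose prk1)
next
  fix i j i' j' assume "i < n" "j < n" "i' < n" "j' < n"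
  then show "\<exists>Y\<in>(\<lambda>X i j. X j i) ` V. Y i j = 0 \<and> Y i' j' = 0 \<and> (\<exists>r<n. \<exists>s<n. Y r s \<noteq> 0)"
    using dim3[of j i j' i'] by auto
qed (rule infinite_field two_neq_0)+

text \<open>A 2 x 2 block of \<open>X\<close> without zeros would force all of \<open>V\<close> to
  be supported on that block. There, an element vanishing on the first row of the block and one
  vanishing on its first column, both nonzero by \<open>dim3\<close>, contradict the polarized
  quadric.\<close>

lemma no_full_block:
  assumes X: "X \<in> V" and ij: "i < n" "i' < n" "j < n" "j' < n" "i \<noteq> i'" "j \<noteq> j'"
    and nz: "X i j \<noteq> 0" "X i j' \<noteq> 0" "X i' j \<noteq> 0" "X i' j' \<noteq> 0"
  shows False
proof -
  \<comment> \<open>Since \<open>a * d + b * c = 0\<close>, the determinant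
    \<open>a * d - b * c\<close> equals \<open>2 * (a * d)\<close>. This is nonzero because the
    characteristic is not 2.\<close>
  have kill: "u = 0 \<and> v = 0"
    if "a * u + b * v = 0" "c * u + d * v = 0" "a * d + b * c = 0" "a \<noteq> 0" "d \<noteq> 0"
    for a b c d u v :: 'a
  proof -
    have "2 * (a * d) * u = d * (a * u + b * v) - b * (c * u + d * v) + u * (a * d + b * c)"
      "2 * (a * d) * v = a * (c * u + d * v) - c * (a * u + b * v) + v * (a * d + b * c)"
      by (simp_all add: algebra_simps)
    then show ?thesis using that two_neq_0 by simp
  qed
  have XX: "X i j * X i' j' + X i j' * X i' j = 0" by (rule quadric[OF X ij])
  \<comment> \<open>For fixed \<open>s\<close>, the quadrics on columns \<open>j\<close>,
    \<open>s\<close> and \<open>j'\<close>, \<open>s\<close> form a linear system in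
    \<open>X i s\<close> and \<open>X i' s\<close> whose coefficients are the block entries, so
    \<open>kill\<close> applies.\<close>
  have Xcol: "X i s = 0 \<and> X i' s = 0" if s: "s < n" "s \<noteq> j" "s \<noteq> j'" for s
    using quadric[OF X, of i i' j s] quadric[OF X, of i i' j' s] ij s nz XX
    by (intro kill[of "X i' j" _ "X i j" _ "X i' j'" "X i j'"]) (auto simp: algebra_simps)
  have Xrow: "X r j = 0 \<and> X r j' = 0" if r: "r < n" "r \<noteq> i" "r \<noteq> i'" for r
    using quadric[OF X, of i r j j'] quadric[OF X, of i' r j j'] ij r nz XX
    by (intro kill[of "X i j'" _ "X i j" _ "X i' j'" "X i' j"]) (auto simp: algebra_simps)
  have Xout: "X r s = 0" if "r < n" "s < n" "r \<noteq> i" "r \<noteq> i'" "s \<noteq> j" "s \<noteq> j'" for r s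
    using quadric[OF X, of i r j s] ij that nz Xcol[of s] by auto
  \<comment> \<open>As \<open>X\<close> vanishes outside the block, polarizing against
    \<open>X\<close> gives linear equations for the entries of \<open>Y\<close> there: a single one
    with coefficient \<open>X i j\<close> if \<open>(r, s)\<close> avoids the rows and columns of
    the block, and otherwise a system for \<open>kill\<close>.\<close>
  have block: "Y r s = 0" if Y: "Y \<in> V" and rs: "r < n" "s < n" "\<not> (r \<in> {i, i'} \<and> s \<in> {j, j'})" for Y r s
  proof -
    consider "r \<notin> {i, i'}" "s \<notin> {j, j'}" | "r \<in> {i, i'}" "s \<notin> {j, j'}" | "r \<notin> {i, i'}" "s \<in> {j, j'}"
      using rs by blast
    then show ?thesis
    proof cases
      case 1
      then show ?thesis
        using polar[OF X Y, of i r j s] ij rs nz Xcol[of s] Xrow[of r] Xout[of r s] by auto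
    next
      case 2
      then have "Y i s = 0 \<and> Y i' s = 0"
        using polar[OF X Y, of i i' j s] polar[OF X Y, of i i' j' s] ij rs nz XX Xcol[of s]
        by (intro kill[of "X i' j" _ "X i j" _ "X i' j'" "X i j'"]) (auto simp: algebra_simps)
      then show ?thesis using 2 by auto
    next
      case 3
      then have "Y r j = 0 \<and> Y r j' = 0"
        using polar[OF X Y, of i r j j'] polar[OF X Y, of i' r j j'] ij rs nz XX Xrow[of r]
        by (intro kill[of "X i j'" _ "X i j" _ "X i' j'" "X i' j"]) (auto simp: algebra_simps)
      then show ?thesis using 3 by auto
    qed
  qed
  obtain Y where Y: "Y \<in> V" "Y i j = 0" "Y i j' = 0" "\<exists>r<n. \<exists>s<n. Y r s \<noteq> 0"
    using dim3[of i j i j'] ij by auto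
  obtain Z where Z: "Z \<in> V" "Z i j = 0" "Z i' j = 0" "\<exists>r<n. \<exists>s<n. Z r s \<noteq> 0"
    using dim3[of i j i' j] ij by auto
  have "Y i' j \<noteq> 0 \<or> Y i' j' \<noteq> 0" using Y block[OF Y(1)] by (metis insertE singletonD)
  then have "Y i' j \<noteq> 0" using polar[OF X Y(1) ij] Y nz by auto
  moreover have "Z i j' \<noteq> 0 \<or> Z i' j' \<noteq> 0" using Z block[OF Z(1)] by (metis insertE singletonD)
  then have "Z i j' \<noteq> 0" using polar[OF X Z(1) ij] Z nz by auto
  \<comment> \<open>Of the four terms of the polarized quadric only \<open>Y i' j * Z i j'\<close>
    remains.\<close>
  ultimately show False using polar[OF Y(1) Z(1) ij] Y Z by auto
qed

text \<open>If \<open>X r j\<close> were nonzero, the quadric would make \<open>X r j'\<close>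
  nonzero and complete a full block. Once \<open>X r j = 0\<close>, the quadric on columns
  \<open>j\<close>, \<open>s\<close> kills \<open>X r s\<close>.\<close>

lemma row_of_two:
  assumes X: "X \<in> V" and ij: "i < n" "j < n" "j' < n" "j \<noteq> j'" and nz: "X i j \<noteq> 0" "X i j' \<noteq> 0"
    and rs: "r < n" "s < n" "r \<noteq> i"
  shows "X r s = 0"
proof -
  have q: "X i j * X r j' + X i j' * X r j = 0" using quadric[OF X] ij rs by auto
  have "X r j = 0"
  proof (rule ccontr)
    assume "X r j \<noteq> 0"
    moreover from this have "X r j' \<noteq> 0" using q nz by auto
    ultimately show False using no_full_block[OF X, of i r j j'] ij rs nz by auto
  qed
  then show ?thesis using quadric[OF X, of i r j s] ij rs nz by (cases "s = j") auto
qed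

text \<open>For generic \<open>t\<close> both \<open>X\<close> and \<open>X + t Y\<close> have two
  nonzero entries in row \<open>i\<close>. Both therefore vanish off this row, and so does
  \<open>Y\<close>.\<close>

lemma space_in_row:
  assumes X: "X \<in> V" and ij: "i < n" "j < n" "j' < n" "j \<noteq> j'" and nz: "X i j \<noteq> 0" "X i j' \<noteq> 0"
    and Y: "Y \<in> V" and rs: "r < n" "s < n" "r \<noteq> i"
  shows "Y r s = 0"
proof -
  \<comment> \<open>The value 0 is excluded so that \<open>Y\<close> can be recovered, the others so
    that the two entries stay nonzero. If the denominator is 0, the quotient is 0 and nothing
    further is excluded.\<close>
  have "finite {0, - X i j / Y i j, - X i j' / Y i j'}" by simp
  then obtain t where t: "t \<notin> {0, - X i j / Y i j, - X i j' / Y i j'}"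
    using infinite_field ex_new_if_finite by blast
  define Z where "Z = (\<lambda>r s. X r s + t * Y r s)"
  have Z: "Z \<in> V" unfolding Z_def by (rule add[OF X scale[OF Y]])
  have "Z i l \<noteq> 0" if "X i l \<noteq> 0" "t \<noteq> - X i l / Y i l" for l
    using that by (cases "Y i l = 0") (auto simp: Z_def field_simps eq_neg_iff_add_eq_0)
  then have "Z r s = 0" using t nz by (intro row_of_two[OF Z ij _ _ rs]) auto
  moreover have "X r s = 0" by (rule row_of_two[OF X ij nz rs])
  ultimately show ?thesis using t by (simp add: Z_def)
qed

text \<open>It suffices to find one element with two nonzero entries in a common row or column; then
  \<open>space_in_row\<close> or its transpose applies.\<close>

lemma in_line:
  assumes "0 < n"
  shows "(\<exists>r<n. \<forall>X\<in>V. \<forall>i<n. \<forall>j<n. i \<noteq> r \<longrightarrow> X i j = 0) \<or>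
    (\<exists>s<n. \<forall>X\<in>V. \<forall>i<n. \<forall>j<n. j \<noteq> s \<longrightarrow> X i j = 0)"
proof -
  interpret tr: prk1_space n "(\<lambda>X i j. X j i) ` V" by (rule transpose)
  obtain X where X: "X \<in> V" "\<exists>r<n. \<exists>s<n. X r s \<noteq> 0" using dim3[of 0 0 0 0] assms by auto
  then obtain i j where ij: "i < n" "j < n" "X i j \<noteq> 0" by auto
  obtain Y where Y: "Y \<in> V" "Y i j = 0" "\<exists>r<n. \<exists>s<n. Y r s \<noteq> 0" using dim3[of i j i j] ij by auto
  then obtain i' j' where ij': "i' < n" "j' < n" "Y i' j' \<noteq> 0" by auto
  \<comment> \<open>Since \<open>Y i j = 0\<close>, adding \<open>Y\<close> when needed makes the
    entry at \<open>(i', j')\<close> nonzero without disturbing the one at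
    \<open>(i, j)\<close>.\<close>
  define Z where "Z = (if X i' j' = 0 then (\<lambda>i j. X i j + Y i j) else X)"
  have Z: "Z \<in> V" using add[OF X(1) Y(1)] X by (simp add: Z_def)
  have nz: "Z i j \<noteq> 0" "Z i' j' \<noteq> 0" using ij ij' Y by (auto simp: Z_def)
  have ne: "i \<noteq> i' \<or> j \<noteq> j'" using Y ij' by auto
  have "(\<exists>i j j'. i < n \<and> j < n \<and> j' < n \<and> j \<noteq> j' \<and> Z i j \<noteq> 0 \<and> Z i j' \<noteq> 0) \<or>
    (\<exists>i i' j. i < n \<and> i' < n \<and> j < n \<and> i \<noteq> i' \<and> Z i j \<noteq> 0 \<and> Z i' j \<noteq> 0)"
  proof (cases "i = i' \<or> j = j'")
    case True
    then show ?thesis using ne nz ij ij' by blast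
  next
    case False
    \<comment> \<open>The first term of the quadric, \<open>Z i j * Z i' j'\<close>, is nonzero, so
      its second term is nonzero too.\<close>
    then have "Z i j' \<noteq> 0" using quadric[OF Z, of i i' j j'] ij ij' nz by auto
    moreover have "j \<noteq> j'" using False by simp
    ultimately show ?thesis using ij ij' nz by blast
  qed
  then show ?thesis
  proof (elim disjE exE conjE)
    fix i j j' assume "i < n" "j < n" "j' < n" "j \<noteq> j'" "Z i j \<noteq> 0" "Z i j' \<noteq> 0"
    then show ?thesis using space_in_row[OF Z] by blast
  next
    fix i i' j assume *: "i < n" "i' < n" "j < n" "i \<noteq> i'" "Z i j \<noteq> 0" "Z i' j \<noteq> 0"
    have "X r s = 0" if "X \<in> V" "r < n" "s < n" "s \<noteq> j" for X r s
      using tr.space_in_row[of "\<lambda>i j. Z j i" j i i' "\<lambda>i j. X j i" s r] Z * that by auto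
    then show ?thesis using *(3) by blast
  qed
qed

end

section \<open>Bijective linear maps preserving permanental rank at most 1\<close>

lemma two_functionals_three_vectors:
  fixes u w :: "nat \<Rightarrow> 'a :: field"
  obtains v0 v1 v2 where "v0 * u 0 + v1 * u 1 + v2 * u 2 = 0" "v0 * w 0 + v1 * w 1 + v2 * w 2 = 0"
    "v0 \<noteq> 0 \<or> v1 \<noteq> 0 \<or> v2 \<noteq> 0"
proof (cases "u 1 * w 2 = u 2 * w 1 \<and> u 2 * w 0 = u 0 * w 2 \<and> u 0 * w 1 = u 1 * w 0")
  case False
  \<comment> \<open>The cross product of \<open>u\<close> and \<open>w\<close> is orthogonal to both
    and here nonzero.\<close>
  show ?thesis
    by (rule that[of "u 1 * w 2 - u 2 * w 1" "u 2 * w 0 - u 0 * w 2" "u 0 * w 1 - u 1 * w 0"])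
      (use False in \<open>auto simp: algebra_simps\<close>)
next
  case True
  \<comment> \<open>Now \<open>u\<close> and \<open>w\<close> are proportional, so a vector
    orthogonal to a nonzero one of them is orthogonal to both; if both are zero, any vector
    works.\<close>
  then show ?thesis
    using that[of "u 1" "- u 0" 0] that[of 0 "u 2" "- u 1"] that[of "w 1" "- w 0" 0]
      that[of 0 "w 2" "- w 1"] that[of 1 0 0]
    by (auto simp: algebra_simps)
qed

text \<open>\<open>M i j\<close> is the image of the matrix unit at \<open>(i, j)\<close> under a bijective linear map that
  preserves permanental rank at most 1.\<close>

locale prk1_map =
  fixes n :: nat and M :: "nat \<Rightarrow> nat \<Rightarrow> nat \<Rightarrow> nat \<Rightarrow> 'a :: field"
  assumes infinite_field: "infinite (UNIV :: 'a set)"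
    and two_neq_0: "(2 :: 'a) \<noteq> 0"
    and n3: "3 \<le> n"
    and pres: "prk1 n a \<Longrightarrow> prk1 n (\<lambda>r s. \<Sum>i<n. \<Sum>j<n. a i j * M i j r s)"
    and inj: "(\<And>r s. r < n \<Longrightarrow> s < n \<Longrightarrow> (\<Sum>i<n. \<Sum>j<n. a i j * M i j r s) = 0) \<Longrightarrow>
      i < n \<Longrightarrow> j < n \<Longrightarrow> a i j = 0"
    and cover: "r < n \<Longrightarrow> s < n \<Longrightarrow> \<exists>i<n. \<exists>j<n. M i j r s \<noteq> 0"
begin

text \<open>Transposing the target exchanges row lines and column lines among the images.\<close>

lemma transpose_image: "prk1_map n (\<lambda>i j r s. M i j s r)"
  by unfold_locales (use infinite_field two_neq_0 n3 cover pres inj in \<open>auto dest: prk1_transpose\<close>)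

text \<open>Transposing the source turns facts about images of rows into facts about images of
  columns.\<close>

lemma transpose_arg: "prk1_map n (\<lambda>i j. M j i)"
proof -
  have sw: "(\<Sum>i<n. \<Sum>j<n. a i j * M j i r s) = (\<Sum>i<n. \<Sum>j<n. a j i * M i j r s)" for a r s
    by (rule sum.swap)
  show ?thesis
  proof
    fix a :: "nat \<Rightarrow> nat \<Rightarrow> 'a" assume "prk1 n a"
    then show "prk1 n (\<lambda>r s. \<Sum>i<n. \<Sum>j<n. a i j * M j i r s)"
      unfolding sw[of a] by (rule pres[OF prk1_transpose])
  next
    fix a :: "nat \<Rightarrow> nat \<Rightarrow> 'a" and i j
    assume "\<And>r s. r < n \<Longrightarrow> s < n \<Longrightarrow> (\<Sum>i<n. \<Sum>j<n. a i j * M j i r s) = 0" "i < n" "j < n"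
    then show "a i j = 0" unfolding sw[of a] using inj[of "\<lambda>i j. a j i" j i] by blast
  next
    fix r s assume "r < n" "s < n"
    then show "\<exists>i<n. \<exists>j<n. M j i r s \<noteq> 0" using cover[of r s] by blast
  qed (use infinite_field two_neq_0 n3 in auto)
qed

lemma sum_row:
  assumes "i0 < n"
  shows "(\<Sum>i<n. \<Sum>j<n. (if i = i0 then v j else 0) * M i j r s) = (\<Sum>j<n. v j * M i0 j r s)"
proof -
  have "(\<Sum>i<n. \<Sum>j<n. (if i = i0 then v j else 0) * M i j r s) =
      (\<Sum>i<n. if i = i0 then \<Sum>j<n. v j * M i0 j r s else 0)"
    by (intro sum.cong refl) auto
  then show ?thesis using assms by simp
qed

lemma row_inj:
  assumes "i0 < n" "\<And>r s. r < n \<Longrightarrow> s < n \<Longrightarrow> (\<Sum>j<n. v j * M i0 j r s) = 0" "j < n"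
  shows "v j = 0"
  using inj[of "\<lambda>i j. if i = i0 then v j else 0" i0 j] sum_row[OF assms(1)] assms by auto

text \<open>Matrices supported in one row satisfy all the quadrics, and by injectivity their images
  form a space of dimension \<open>n\<close>, which is at least 3.\<close>

lemma row_space:
  assumes i0: "i0 < n"
  shows "prk1_space n (range (\<lambda>v r s. \<Sum>j<n. v j * M i0 j r s))" (is "prk1_space n ?V")
proof
  fix X Y assume "X \<in> ?V" "Y \<in> ?V"
  then obtain v w where "X = (\<lambda>r s. \<Sum>j<n. v j * M i0 j r s)" "Y = (\<lambda>r s. \<Sum>j<n. w j * M i0 j r s)"
    by auto
  then have "(\<lambda>i j. X i j + Y i j) = (\<lambda>r s. \<Sum>j<n. (v j + w j) * M i0 j r s)"
    by (simp add: sum.distrib algebra_simps)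
  then show "(\<lambda>i j. X i j + Y i j) \<in> ?V" by (rule range_eqI[where x = "\<lambda>j. v j + w j"])
next
  fix X t assume "X \<in> ?V"
  then obtain v where "X = (\<lambda>r s. \<Sum>j<n. v j * M i0 j r s)" by auto
  then have "(\<lambda>i j. t * X i j) = (\<lambda>r s. \<Sum>j<n. (t * v j) * M i0 j r s)"
    by (simp add: sum_distrib_left algebra_simps)
  then show "(\<lambda>i j. t * X i j) \<in> ?V" by (rule range_eqI[where x = "\<lambda>j. t * v j"])
next
  fix X assume "X \<in> ?V"
  then obtain v where "X = (\<lambda>r s. \<Sum>j<n. v j * M i0 j r s)" by auto
  then have X: "X = (\<lambda>r s. \<Sum>i<n. \<Sum>j<n. (if i = i0 then v j else 0) * M i j r s)"
    using sum_row[OF i0] by simp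
  show "prk1 n X" unfolding X by (intro pres) (auto simp: prk1_def)
next
  fix i j i' j' assume *: "i < n" "j < n" "i' < n" "j' < n"
  \<comment> \<open>A nontrivial combination of the images of three units in the row meets both
    conditions, and injectivity makes it nonzero.\<close>
  obtain v0 v1 v2 where v: "v0 * M i0 0 i j + v1 * M i0 1 i j + v2 * M i0 2 i j = 0"
    "v0 * M i0 0 i' j' + v1 * M i0 1 i' j' + v2 * M i0 2 i' j' = 0" "v0 \<noteq> 0 \<or> v1 \<noteq> 0 \<or> v2 \<noteq> 0"
    by (rule two_functionals_three_vectors[of "\<lambda>l. M i0 l i j" "\<lambda>l. M i0 l i' j'"])
  define v where "v = (\<lambda>_. 0)(0 := v0, 1 := v1, Suc 1 := v2)"
  define Y where "Y = (\<lambda>r s. \<Sum>j<n. v j * M i0 j r s)"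
  have Yeq: "Y r s = v0 * M i0 0 r s + v1 * M i0 1 r s + v2 * M i0 2 r s" for r s
  proof -
    have "Y r s = (\<Sum>j\<in>{0, 1, 2}. v j * M i0 j r s)"
      unfolding Y_def using n3 by (intro sum.mono_neutral_right) (auto simp: v_def)
    then show ?thesis by (simp add: v_def numeral_2_eq_2 add.assoc)
  qed
  have "\<exists>r<n. \<exists>s<n. Y r s \<noteq> 0"
  proof (rule ccontr)
    assume "\<not> ?thesis"
    then have "v l = 0" if "l < n" for l
      using row_inj[OF i0, of v l] that by (auto simp: Y_def)
    from this[of 0] this[of 1] this[of 2] show False using v(3) n3 by (auto simp: v_def numeral_2_eq_2)
  qed
  then show "\<exists>Y\<in>?V. Y i j = 0 \<and> Y i' j' = 0 \<and> (\<exists>r<n. \<exists>s<n. Y r s \<noteq> 0)"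
  proof (intro bexI[of _ Y] conjI)
    show "Y i j = 0" "Y i' j' = 0" using v(1,2) by (simp_all only: Yeq)
    show "Y \<in> ?V" unfolding Y_def by (rule rangeI)
  qed
qed (rule infinite_field two_neq_0)+

lemma row_in_line:
  assumes "i < n"
  shows "(\<exists>r<n. \<forall>j<n. \<forall>x<n. \<forall>y<n. x \<noteq> r \<longrightarrow> M i j x y = 0) \<or>
    (\<exists>s<n. \<forall>j<n. \<forall>x<n. \<forall>y<n. y \<noteq> s \<longrightarrow> M i j x y = 0)"
proof -
  interpret R: prk1_space n "range (\<lambda>v r s. \<Sum>j<n. v j * M i j r s)" by (rule row_space[OF assms])
  have mem: "(\<lambda>r s. M i j r s) \<in> range (\<lambda>v r s. \<Sum>j<n. v j * M i j r s)" if "j < n" for j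
  proof (rule range_eqI)
    have "(\<Sum>l<n. (if l = j then 1 else 0) * M i l r s) = (\<Sum>l<n. if l = j then M i j r s else 0)" for r s
      by (intro sum.cong) auto
    then show "(\<lambda>r s. M i j r s) = (\<lambda>r s. \<Sum>l<n. (if l = j then 1 else 0) * M i l r s)"
      using that by simp
  qed
  have "0 < n" using n3 by simp
  from R.in_line[OF this] show ?thesis
  proof (elim disjE exE conjE)
    fix r assume r: "r < n" "\<forall>X\<in>range (\<lambda>v r s. \<Sum>j<n. v j * M i j r s). \<forall>i<n. \<forall>j<n. i \<noteq> r \<longrightarrow> X i j = 0"
    show ?thesis using r(1) bspec[OF r(2) mem] by auto
  next
    fix s assume s: "s < n" "\<forall>X\<in>range (\<lambda>v r s. \<Sum>j<n. v j * M i j r s). \<forall>i<n. \<forall>j<n. j \<noteq> s \<longrightarrow> X i j = 0"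
    show ?thesis using s(1) bspec[OF s(2) mem] by auto
  qed
qed

text \<open>The lines containing the images of the \<open>n\<close> rows must cover all positions, so they are
  pairwise distinct and all parallel.\<close>

lemma rows_to_parallel_lines:
  "(\<exists>\<rho>. bij_betw \<rho> {..<n} {..<n} \<and> (\<forall>i<n. \<forall>j<n. \<forall>x<n. \<forall>y<n. x \<noteq> \<rho> i \<longrightarrow> M i j x y = 0)) \<or>
   (\<exists>\<kappa>. bij_betw \<kappa> {..<n} {..<n} \<and> (\<forall>i<n. \<forall>j<n. \<forall>x<n. \<forall>y<n. y \<noteq> \<kappa> i \<longrightarrow> M i j x y = 0))"
proof -
  define R where "R i r \<longleftrightarrow> r < n \<and> (\<forall>j<n. \<forall>x<n. \<forall>y<n. x \<noteq> r \<longrightarrow> M i j x y = 0)" for i r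
  define C where "C i s \<longleftrightarrow> s < n \<and> (\<forall>j<n. \<forall>x<n. \<forall>y<n. y \<noteq> s \<longrightarrow> M i j x y = 0)" for i s
  define A where "A = {i. i < n \<and> (\<exists>r. R i r)}"
  define B where "B = {..<n} - A"
  define \<rho> where "\<rho> i = (SOME r. R i r)" for i
  define \<kappa> where "\<kappa> i = (SOME s. C i s)" for i
  have \<rho>: "R i (\<rho> i)" if "i \<in> A" for i
    using that unfolding A_def \<rho>_def by (auto intro: someI)
  have \<kappa>: "C i (\<kappa> i)" if "i \<in> B" for i
  proof -
    have "\<exists>s. C i s" using row_in_line[of i] that unfolding B_def A_def R_def C_def by auto
    then show ?thesis unfolding \<kappa>_def by (auto intro: someI)
  qed
  have sub: "A \<subseteq> {..<n}" by (auto simp: A_def)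
  \<comment> \<open>If the row lines miss a row \<open>r\<close> and the column lines miss a column
    \<open>s\<close>, no image reaches \<open>(r, s)\<close>. So lines of one kind suffice, and
    counting shows that all \<open>n\<close> rows are needed for it.\<close>
  have "{..<n} \<subseteq> \<rho> ` A \<or> {..<n} \<subseteq> \<kappa> ` B"
  proof (rule ccontr)
    assume "\<not> ?thesis"
    then obtain r s where rs: "r < n" "r \<notin> \<rho> ` A" "s < n" "s \<notin> \<kappa> ` B" by auto
    have "M i j r s = 0" if "i < n" "j < n" for i j
    proof (cases "i \<in> A")
      case True
      then have "r \<noteq> \<rho> i" using rs by auto
      then show ?thesis using \<rho>[OF True] rs that unfolding R_def by blast
    next
      case False
      then have "i \<in> B" using that by (simp add: B_def)
      moreover from this have "s \<noteq> \<kappa> i" using rs by auto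
      ultimately show ?thesis using \<kappa>[of i] rs that unfolding C_def by blast
    qed
    then show False using cover[OF rs(1,3)] by auto
  qed
  then show ?thesis
  proof
    assume s: "{..<n} \<subseteq> \<rho> ` A"
    have "card {..<n} \<le> card A" using s sub by (meson finite_lessThan finite_subset surj_card_le)
    then have "A = {..<n}" using sub by (intro card_seteq) auto
    moreover have "\<rho> ` A = {..<n}" using s \<rho> unfolding R_def by blast
    ultimately have bij: "bij_betw \<rho> {..<n} {..<n}"
      by (simp add: bij_betw_def eq_card_imp_inj_on)
    have "R i (\<rho> i)" if "i < n" for i using \<rho> \<open>A = {..<n}\<close> that by blast
    then show ?thesis unfolding R_def by (intro disjI1 exI[of _ \<rho>] conjI bij) blast
  next
    assume s: "{..<n} \<subseteq> \<kappa> ` B"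
    have "card {..<n} \<le> card B" using s
      by (metis B_def finite_Diff finite_lessThan surj_card_le)
    then have "B = {..<n}" by (intro card_seteq) (auto simp: B_def)
    moreover have "\<kappa> ` B = {..<n}" using s \<kappa> unfolding C_def by blast
    ultimately have bij: "bij_betw \<kappa> {..<n} {..<n}"
      by (simp add: bij_betw_def eq_card_imp_inj_on)
    have "C i (\<kappa> i)" if "i < n" for i using \<kappa> \<open>B = {..<n}\<close> that by blast
    then show ?thesis unfolding C_def by (intro disjI2 exI[of _ \<kappa>] conjI bij) blast
  qed
qed

lemma unit_image_nonzero:
  assumes "i < n" "j < n"
  shows "\<exists>r<n. \<exists>s<n. M i j r s \<noteq> 0"
proof (rule ccontr)
  assume "\<not> ?thesis"
  then have z: "M i j r s = 0" if "r < n" "s < n" for r s using that by blast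
  \<comment> \<open>This is the coefficient at \<open>j\<close> of the indicator vector of
    \<open>j\<close>, which \<open>row_inj\<close> would force to vanish.\<close>
  have "(if j = j then 1 else 0 :: 'a) = 0"
  proof (rule row_inj[OF assms(1) _ assms(2), of "\<lambda>l. if l = j then 1 else 0"])
    fix r s assume "r < n" "s < n"
    then show "(\<Sum>l<n. (if l = j then 1 else 0) * M i l r s) = 0"
      using z by (intro sum.neutral) auto
  qed
  then show False by simp
qed

text \<open>Each unit at \<open>(i, j)\<close> goes to a multiple \<open>c i j\<close> of the unit
  at \<open>(\<rho> i, \<kappa> j)\<close>. Zero-permanent blocks keep zero permanent, so the 2 x 2
  minors of \<open>c\<close> vanish and \<open>c\<close> factors as
  \<open>d i * e j\<close>.\<close>

lemma monomial_structure:
  assumes \<rho>: "bij_betw \<rho> {..<n} {..<n}" "\<And>i j x y. i < n \<Longrightarrow> j < n \<Longrightarrow> x < n \<Longrightarrow> y < n \<Longrightarrow> x \<noteq> \<rho> i \<Longrightarrow> M i j x y = 0"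
    and \<kappa>: "bij_betw \<kappa> {..<n} {..<n}" "\<And>i j x y. i < n \<Longrightarrow> j < n \<Longrightarrow> x < n \<Longrightarrow> y < n \<Longrightarrow> y \<noteq> \<kappa> j \<Longrightarrow> M i j x y = 0"
  obtains d e where "\<And>i. i < n \<Longrightarrow> d i \<noteq> 0" "\<And>j. j < n \<Longrightarrow> e j \<noteq> 0"
    "\<And>a i j. i < n \<Longrightarrow> j < n \<Longrightarrow> (\<Sum>i'<n. \<Sum>j'<n. a i' j' * M i' j' (\<rho> i) (\<kappa> j)) = d i * e j * a i j"
proof -
  define c where "c i j = M i j (\<rho> i) (\<kappa> j)" for i j
  have \<rho>n: "\<rho> i < n" if "i < n" for i using \<rho>(1) that by (auto simp: bij_betw_def)
  have \<kappa>n: "\<kappa> i < n" if "i < n" for i using \<kappa>(1) that by (auto simp: bij_betw_def)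
  have c0: "c i j \<noteq> 0" if "i < n" "j < n" for i j
    using unit_image_nonzero[OF that] \<rho>(2) \<kappa>(2) that unfolding c_def by metis
  have L: "(\<Sum>i'<n. \<Sum>j'<n. a i' j' * M i' j' (\<rho> i) (\<kappa> j)) = c i j * a i j"
    if ij: "i < n" "j < n" for a i j
  proof -
    have z: "M i' j' (\<rho> i) (\<kappa> j) = (if i' = i \<and> j' = j then c i j else 0)" if "i' < n" "j' < n" for i' j'
    proof (cases "i' = i \<and> j' = j")
      case False
      then have "\<rho> i \<noteq> \<rho> i' \<or> \<kappa> j \<noteq> \<kappa> j'"
        using ij that \<rho>(1)[THEN bij_betw_imp_inj_on] \<kappa>(1)[THEN bij_betw_imp_inj_on]
        by (auto simp: inj_on_eq_iff)
      then have "M i' j' (\<rho> i) (\<kappa> j) = 0" using \<rho>(2) \<kappa>(2) ij that \<rho>n \<kappa>n by metis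
      then show ?thesis using False by auto
    qed (simp add: c_def)
    have "(\<Sum>i'<n. \<Sum>j'<n. a i' j' * M i' j' (\<rho> i) (\<kappa> j)) =
        (\<Sum>i'<n. if i' = i then \<Sum>j'<n. if j' = j then a i j * c i j else 0 else 0)"
    proof (intro sum.cong refl)
      fix i' assume "i' \<in> {..<n}"
      then show "(\<Sum>j'<n. a i' j' * M i' j' (\<rho> i) (\<kappa> j)) =
          (if i' = i then \<Sum>j'<n. if j' = j then a i j * c i j else 0 else 0)"
        using ij by (simp add: z if_distrib[of "(*) _"] cong: if_cong)
    qed
    then show ?thesis using ij by simp
  qed
  have rank1: "c i j * c i' j' = c i j' * c i' j" if ij: "i < n" "j < n" "i' < n" "j' < n" for i j i' j'
  proof (cases "i = i' \<or> j = j'")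
    case False
    \<comment> \<open>The block with entries 1, 1, 1, -1 has zero permanent; the sign turns the
      permanent condition on its image into a vanishing minor of \<open>c\<close>.\<close>
    define a :: "nat \<Rightarrow> nat \<Rightarrow> 'a" where
      "a x y = (if x \<in> {i, i'} \<and> y \<in> {j, j'} then if x = i' \<and> y = j' then - 1 else 1 else 0)" for x y
    have "prk1 n a"
      unfolding prk1_def
    proof (intro allI impI)
      fix x x' y y' :: nat assume *: "x \<noteq> x'" "y \<noteq> y'"
      show "a x y * a x' y' + a x y' * a x' y = 0"
      proof (cases "x \<in> {i, i'} \<and> x' \<in> {i, i'} \<and> y \<in> {j, j'} \<and> y' \<in> {j, j'}")
        case True
        then show ?thesis using * False by (auto simp: a_def)
      next
        case False
        then show ?thesis by (auto simp: a_def)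
      qed
    qed
    then have im: "prk1 n (\<lambda>r s. \<Sum>i<n. \<Sum>j<n. a i j * M i j r s)" by (rule pres)
    have ne: "\<rho> i \<noteq> \<rho> i'" "\<kappa> j \<noteq> \<kappa> j'"
      using ij False \<rho>(1)[THEN bij_betw_imp_inj_on] \<kappa>(1)[THEN bij_betw_imp_inj_on]
      by (auto simp: inj_on_eq_iff)
    have "c i j * a i j * (c i' j' * a i' j') + c i j' * a i j' * (c i' j * a i' j) = 0"
      using im[unfolded prk1_def, rule_format, OF \<rho>n[OF ij(1)] \<rho>n[OF ij(3)] \<kappa>n[OF ij(2)] \<kappa>n[OF ij(4)] ne]
      by (simp only: L ij)
    then show ?thesis using False by (auto simp: a_def)
  qed auto
  show ?thesis
  \<comment> \<open>The factors are the first column and the first row of \<open>c\<close>, divided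
    by the corner entry, which both contain.\<close>
  proof (rule that[of "\<lambda>i. c i 0" "\<lambda>j. c 0 j / c 0 0"])
    fix a i j assume ij: "i < n" "j < n"
    have "c i j = c i 0 * (c 0 j / c 0 0)" using rank1[of i j 0 0] c0[of 0 0] ij by (simp add: field_simps)
    then show "(\<Sum>i'<n. \<Sum>j'<n. a i' j' * M i' j' (\<rho> i) (\<kappa> j)) = c i 0 * (c 0 j / c 0 0) * a i j"
      using L[OF ij] by simp
  qed (use c0 n3 in auto)
qed

text \<open>If columns also went into rows, all units of one column would have images in a single
  row, contradicting the injectivity of \<open>\<rho>\<close>. So columns go into columns and
  \<open>monomial_structure\<close> applies; \<open>\<alpha>\<close> and \<open>\<beta>\<close> are
  the inverses of \<open>\<rho>\<close> and \<open>\<kappa>\<close>.\<close>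

lemma semimonomial_of_rows:
  assumes \<rho>: "bij_betw \<rho> {..<n} {..<n}" "\<forall>i<n. \<forall>j<n. \<forall>x<n. \<forall>y<n. x \<noteq> \<rho> i \<longrightarrow> M i j x y = 0"
  shows "\<exists>\<alpha> \<beta> d e. \<alpha> permutes {0..<n} \<and> \<beta> permutes {0..<n} \<and> (\<forall>r<n. d r \<noteq> 0) \<and> (\<forall>s<n. e s \<noteq> 0) \<and>
    (\<forall>a. \<forall>r<n. \<forall>s<n. (\<Sum>i<n. \<Sum>j<n. a i j * M i j r s) = d r * e s * a (\<alpha> r) (\<beta> s))"
proof -
  interpret tr: prk1_map n "\<lambda>i j. M j i" by (rule transpose_arg)
  obtain \<kappa> where \<kappa>: "bij_betw \<kappa> {..<n} {..<n}" "\<forall>j<n. \<forall>i<n. \<forall>x<n. \<forall>y<n. y \<noteq> \<kappa> j \<longrightarrow> M i j x y = 0"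
    using tr.rows_to_parallel_lines
  proof (elim disjE exE conjE)
    fix \<rho>' assume \<rho>': "\<forall>j<n. \<forall>i<n. \<forall>x<n. \<forall>y<n. x \<noteq> \<rho>' j \<longrightarrow> M i j x y = 0"
    \<comment> \<open>The nonzero image of the unit at \<open>(i, 0)\<close> lies both in row
      \<open>\<rho> i\<close> and in row \<open>\<rho>' 0\<close>.\<close>
    have "\<rho> i = \<rho>' 0" if "i < n" for i
      using unit_image_nonzero[of i 0] \<rho>(2) \<rho>' that n3
      by (metis gr0I not_numeral_le_zero)
    from this[of 0] this[of 1] have "\<rho> 0 = \<rho> 1" using n3 by simp
    then have False using \<rho>(1)[THEN bij_betw_imp_inj_on, THEN inj_onD, of 0 1] n3 by simp
    then show ?thesis ..
  qed (use that in blast)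
  obtain d e where de: "\<And>i. i < n \<Longrightarrow> d i \<noteq> 0" "\<And>j. j < n \<Longrightarrow> e j \<noteq> 0"
    "\<And>a i j. i < n \<Longrightarrow> j < n \<Longrightarrow> (\<Sum>i'<n. \<Sum>j'<n. a i' j' * M i' j' (\<rho> i) (\<kappa> j)) = d i * e j * a i j"
  proof (rule monomial_structure[OF \<rho>(1) _ \<kappa>(1)])
    show "M i j x y = 0" if "i < n" "j < n" "x < n" "y < n" "x \<noteq> \<rho> i" for i j x y
      using \<rho>(2) that by blast
    show "M i j x y = 0" if "i < n" "j < n" "x < n" "y < n" "y \<noteq> \<kappa> j" for i j x y
      using \<kappa>(2) that by blast
  qed (rule that)
  have inv: "\<exists>\<alpha>. \<alpha> permutes {0..<n} \<and> (\<forall>r<n. \<alpha> r < n \<and> \<pi> (\<alpha> r) = r)"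
    if \<pi>: "bij_betw \<pi> {..<n} {..<n}" for \<pi>
  proof (intro exI conjI)
    let ?\<alpha> = "\<lambda>r. if r \<in> {..<n} then inv_into {..<n} \<pi> r else r"
    have "bij_betw ?\<alpha> {..<n} {..<n}"
      using bij_betw_inv_into[OF \<pi>] by (subst bij_betw_cong[of _ _ "inv_into {..<n} \<pi>"]) auto
    then show "?\<alpha> permutes {0..<n}" by (intro bij_imp_permutes) (auto simp: atLeast0LessThan)
    show "\<forall>r<n. ?\<alpha> r < n \<and> \<pi> (?\<alpha> r) = r"
      using \<pi> bij_betw_inv_into_right[OF \<pi>] bij_betwE[OF bij_betw_inv_into[OF \<pi>]] by auto
  qed
  obtain \<alpha> \<beta> where \<alpha>: "\<alpha> permutes {0..<n}" "\<forall>r<n. \<alpha> r < n \<and> \<rho> (\<alpha> r) = r"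
    and \<beta>: "\<beta> permutes {0..<n}" "\<forall>r<n. \<beta> r < n \<and> \<kappa> (\<beta> r) = r"
    using inv[OF \<rho>(1)] inv[OF \<kappa>(1)] by blast
  show ?thesis
  proof (rule exI[of _ \<alpha>], rule exI[of _ \<beta>], rule exI[of _ "\<lambda>r. d (\<alpha> r)"],
      rule exI[of _ "\<lambda>s. e (\<beta> s)"], intro conjI allI impI)
    fix a r s assume rs: "r < n" "s < n"
    show "(\<Sum>i<n. \<Sum>j<n. a i j * M i j r s) = d (\<alpha> r) * e (\<beta> s) * a (\<alpha> r) (\<beta> s)"
      using de(3)[of "\<alpha> r" "\<beta> s" a] \<alpha>(2) \<beta>(2) rs by simp
  qed (use \<alpha> \<beta> de in auto)
qed

lemma semimonomial:
  "\<exists>\<alpha> \<beta> d e. \<alpha> permutes {0..<n} \<and> \<beta> permutes {0..<n} \<and> (\<forall>r<n. d r \<noteq> 0) \<and> (\<forall>s<n. e s \<noteq> 0) \<and>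
    ((\<forall>a. \<forall>r<n. \<forall>s<n. (\<Sum>i<n. \<Sum>j<n. a i j * M i j r s) = d r * e s * a (\<alpha> r) (\<beta> s)) \<or>
     (\<forall>a. \<forall>r<n. \<forall>s<n. (\<Sum>i<n. \<Sum>j<n. a i j * M i j r s) = d r * e s * a (\<beta> s) (\<alpha> r)))"
  using rows_to_parallel_lines
proof (elim disjE exE conjE)
  fix \<rho> assume "bij_betw \<rho> {..<n} {..<n}" "\<forall>i<n. \<forall>j<n. \<forall>x<n. \<forall>y<n. x \<noteq> \<rho> i \<longrightarrow> M i j x y = 0"
  from semimonomial_of_rows[OF this] show ?thesis
  proof (elim exE conjE)
    fix \<alpha> \<beta> d e
    assume "\<alpha> permutes {0..<n}" "\<beta> permutes {0..<n}" "\<forall>r<n. d r \<noteq> 0" "\<forall>s<n. e s \<noteq> 0"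
      "\<forall>a. \<forall>r<n. \<forall>s<n. (\<Sum>i<n. \<Sum>j<n. a i j * M i j r s) = d r * e s * a (\<alpha> r) (\<beta> s)"
    then show ?thesis
      by - (rule exI[of _ \<alpha>], rule exI[of _ \<beta>], rule exI[of _ d], rule exI[of _ e], intro conjI disjI1)
  qed
next
  interpret tr: prk1_map n "\<lambda>i j r s. M i j s r" by (rule transpose_image)
  fix \<kappa> assume "bij_betw \<kappa> {..<n} {..<n}" "\<forall>i<n. \<forall>j<n. \<forall>x<n. \<forall>y<n. y \<noteq> \<kappa> i \<longrightarrow> M i j x y = 0"
  then obtain \<alpha> \<beta> d e where *: "\<alpha> permutes {0..<n}" "\<beta> permutes {0..<n}" "\<forall>r<n. d r \<noteq> 0" "\<forall>s<n. e s \<noteq> 0"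
    "\<forall>a. \<forall>r<n. \<forall>s<n. (\<Sum>i<n. \<Sum>j<n. a i j * M i j s r) = d r * e s * a (\<alpha> r) (\<beta> s)"
    using tr.semimonomial_of_rows[of \<kappa>] by blast
  \<comment> \<open>Transposing the target exchanges its row and column indices, hence the swapped
    witnesses.\<close>
  show ?thesis
    by (rule exI[of _ \<beta>], rule exI[of _ \<alpha>], rule exI[of _ e], rule exI[of _ d])
      (use * in \<open>simp add: mult.commute\<close>)
qed

end

section \<open>Descent to permanental rank at most 1\<close>

lemma vanish_cong:
  assumes "\<And>i j. i < n \<Longrightarrow> j < n \<Longrightarrow> a i j = b i j"
  shows "vanish n k a \<longleftrightarrow> vanish n k b"
proof -
  have "per a I J = per b I J" if "I \<subseteq> {0..<n}" "J \<subseteq> {0..<n}" for I J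
    using that by (intro per_cong assms) auto
  then show ?thesis unfolding vanish_def by simp
qed

text \<open>A subpermanent of size \<open>k + 2\<close> changes by at most \<open>x\<close> times
  one of size \<open>k + 1\<close>, and all of these vanish.\<close>

lemma vanish_add_unit:
  assumes "vanish n k a"
  shows "vanish n (Suc k) (\<lambda>i j. a i j + x * unit_fun i0 j0 i j)"
  unfolding vanish_def
proof (intro allI impI)
  fix I J assume IJ: "I \<subseteq> {0..<n}" "J \<subseteq> {0..<n}" "card I = Suc (Suc k)" "card J = Suc (Suc k)"
  have fin: "finite I" "finite J" using IJ by (auto intro: finite_subset)
  have 0: "per a I J = 0" using vanish_Suc[OF assms] IJ unfolding vanish_def by blast
  show "per (\<lambda>i j. a i j + x * unit_fun i0 j0 i j) I J = 0"
  proof (cases "i0 \<in> I \<and> j0 \<in> J")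
    case True
    have "I - {i0} \<subseteq> {0..<n}" "J - {j0} \<subseteq> {0..<n}" using IJ by auto
    moreover have "card (I - {i0}) = Suc k" "card (J - {j0}) = Suc k" using True IJ by simp_all
    ultimately have "per a (I - {i0}) (J - {j0}) = 0" using assms unfolding vanish_def by blast
    then show ?thesis using True 0 by (simp add: per_add_unit fin)
  qed (simp add: per_add_unit_outside 0)
qed

lemma prk_attained:
  assumes "A \<in> carrier_mat n n"
  obtains I J where "I \<subseteq> {0..<n}" "J \<subseteq> {0..<n}" "card I = prk A" "card J = prk A"
    "per (\<lambda>i j. A $$ (i, j)) I J \<noteq> 0"
proof (cases "prk A")
  case 0
  then show ?thesis using that[of "{}" "{}"] by (simp add: per_empty)
next
  case (Suc k)
  then have "\<not> vanish n k (\<lambda>i j. A $$ (i, j))"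
    using prk_le_iff_vanish[OF assms, of k] by simp
  then show ?thesis using that Suc unfolding vanish_def by auto
qed

definition unit_mat :: "nat \<Rightarrow> nat \<Rightarrow> nat \<Rightarrow> 'a :: comm_ring_1 mat" where
  "unit_mat n i j = mat n n (\<lambda>(r, s). unit_fun i j r s)"

lemma unit_mat_carrier [simp]: "unit_mat n i j \<in> carrier_mat n n"
  by (simp add: unit_mat_def)

lemma vanish_add_unit_mat:
  assumes "A \<in> carrier_mat n n"
  shows "vanish n k (\<lambda>r s. (A + x \<cdot>\<^sub>m unit_mat n i j) $$ (r, s)) \<longleftrightarrow>
    vanish n k (\<lambda>r s. A $$ (r, s) + x * unit_fun i j r s)"
  using assms by (intro vanish_cong) (simp add: unit_mat_def)

text \<open>A nonzero subpermanent of maximal size is enlarged by a row and a column outside it. The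
  enlarged one is affine in \<open>x\<close> with nonzero slope, and \<open>x0\<close> is its
  root.\<close>

lemma prk_raise:
  fixes A :: "'a :: field mat"
  assumes A: "A \<in> carrier_mat n n" and lt: "prk A < n"
  obtains i j x0 where "i < n" "j < n"
    "\<And>x. x \<noteq> x0 \<Longrightarrow> prk (A + x \<cdot>\<^sub>m unit_mat n i j) = Suc (prk A)"
proof -
  let ?a = "\<lambda>i j. A $$ (i, j)"
  obtain I J where IJ: "I \<subseteq> {0..<n}" "J \<subseteq> {0..<n}" "card I = prk A" "card J = prk A" "per ?a I J \<noteq> 0"
    by (rule prk_attained[OF A])
  have fin: "finite I" "finite J" using IJ by (auto intro: finite_subset)
  obtain i j where ij: "i < n" "i \<notin> I" "j < n" "j \<notin> J"
    using IJ lt by (metis atLeast0LessThan card_lessThan lessThan_iff nat_neq_iff subsetI subset_antisym)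
  show ?thesis
  proof (rule that[OF ij(1,3), of "- per ?a (insert i I) (insert j J) / per ?a I J"])
    fix x assume x: "x \<noteq> - per ?a (insert i I) (insert j J) / per ?a I J"
    let ?B = "A + x \<cdot>\<^sub>m unit_mat n i j"
    have B: "?B \<in> carrier_mat n n" using A by simp
    have "prk ?B \<le> Suc (prk A)"
      using prk_le_iff_vanish[OF A, of "prk A"] vanish_add_unit[of n "prk A" ?a x i j]
      by (simp add: prk_le_iff_vanish[OF B] vanish_add_unit_mat[OF A])
    moreover have "\<not> prk ?B \<le> prk A"
    proof
      assume "prk ?B \<le> prk A"
      then have "vanish n (prk A) (\<lambda>r s. A $$ (r, s) + x * unit_fun i j r s)"
        using prk_le_iff_vanish[OF B] vanish_add_unit_mat[OF A] by blast
      moreover have "insert i I \<subseteq> {0..<n}" "insert j J \<subseteq> {0..<n}"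
        "card (insert i I) = Suc (prk A)" "card (insert j J) = Suc (prk A)"
        using IJ ij fin by auto
      ultimately have "per (\<lambda>r s. A $$ (r, s) + x * unit_fun i j r s) (insert i I) (insert j J) = 0"
        unfolding vanish_def by blast
      then have "per ?a (insert i I) (insert j J) + x * per ?a I J = 0"
        using ij fin by (simp add: per_add_unit)
      then show False using x IJ(5) by (simp add: field_simps eq_neg_iff_add_eq_0)
    qed
    ultimately show "prk ?B = Suc (prk A)" by simp
  qed
qed

section \<open>Linear maps: expansion in matrix units and descent of the preserved rank
  bound\<close>

lemma linear_mat_mapD:
  assumes "linear_mat_map n T"
  shows "A \<in> carrier_mat n n \<Longrightarrow> T A \<in> carrier_mat n n"
    and "A \<in> carrier_mat n n \<Longrightarrow> B \<in> carrier_mat n n \<Longrightarrow> T (A + B) = T A + T B"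
    and "A \<in> carrier_mat n n \<Longrightarrow> T (c \<cdot>\<^sub>m A) = c \<cdot>\<^sub>m T A"
  using assms unfolding linear_mat_map_def by auto

lemma linear_mat_map_zero:
  assumes "linear_mat_map n T"
  shows "T (0\<^sub>m n n) = 0\<^sub>m n n"
proof -
  have "T (0 \<cdot>\<^sub>m 0\<^sub>m n n) = 0 \<cdot>\<^sub>m T (0\<^sub>m n n)"
    by (rule linear_mat_mapD(3)[OF assms]) simp
  moreover have "0 \<cdot>\<^sub>m B = 0\<^sub>m n n" if "B \<in> carrier_mat n n" for B :: "'a mat"
    using that by (intro eq_matI) auto
  ultimately show ?thesis using linear_mat_mapD(1)[OF assms] by simp
qed

lemma linear_mat_map_expand:
  fixes T :: "'a :: comm_ring_1 mat \<Rightarrow> 'a mat"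
  assumes T: "linear_mat_map n T" and rs: "r < n" "s < n"
  shows "T (mat n n (\<lambda>(i, j). a i j)) $$ (r, s) = (\<Sum>i<n. \<Sum>j<n. a i j * T (unit_mat n i j) $$ (r, s))"
proof -
  note T' = linear_mat_mapD[OF T]
  \<comment> \<open>The support is an arbitrary finite set of positions, so that the induction adds
    one matrix unit at a time.\<close>
  have "T (mat n n (\<lambda>p. if p \<in> S then a (fst p) (snd p) else 0)) $$ (r, s) =
      (\<Sum>p\<in>S. a (fst p) (snd p) * T (unit_mat n (fst p) (snd p)) $$ (r, s))"
    if "finite S" for S
    using that
  proof (induction S rule: finite_induct)
    case empty
    have "mat n n (\<lambda>p. 0) = (0\<^sub>m n n :: 'a mat)" by (intro eq_matI) auto
    then show ?case using rs linear_mat_map_zero[OF T] by simp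
  next
    case (insert p S)
    have "mat n n (\<lambda>q. if q \<in> insert p S then a (fst q) (snd q) else 0) =
        mat n n (\<lambda>q. if q \<in> S then a (fst q) (snd q) else 0) +
        a (fst p) (snd p) \<cdot>\<^sub>m unit_mat n (fst p) (snd p)"
      using insert(2) by (intro eq_matI) (auto simp: unit_mat_def unit_fun_def)
    moreover have "T (unit_mat n (fst p) (snd p)) \<in> carrier_mat n n" by (rule T'(1)) simp
    ultimately show ?case
      using insert rs carrier_matD[of "T (unit_mat n (fst p) (snd p))" n n]
      by (simp add: T'(2,3))
  qed
  from this[of "{..<n} \<times> {..<n}"]
  have "T (mat n n (\<lambda>p. if p \<in> {..<n} \<times> {..<n} then a (fst p) (snd p) else 0)) $$ (r, s) =
      (\<Sum>i<n. \<Sum>j<n. a i j * T (unit_mat n i j) $$ (r, s))"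
    by (simp add: sum.cartesian_product case_prod_unfold)
  moreover have "mat n n (\<lambda>p. if p \<in> {..<n} \<times> {..<n} then a (fst p) (snd p) else 0) = mat n n (\<lambda>(i, j). a i j)"
    by (intro eq_matI) auto
  ultimately show ?thesis by simp
qed

text \<open>The rank of \<open>A\<close> is raised in single steps up to \<open>k\<close>. The
  induction hypothesis covers \<open>A + x E\<close> for all \<open>x\<close> but \<open>x0\<close>;
  the subpermanents of its image then vanish identically in \<open>x\<close>, in particular at
  0.\<close>

lemma preserves_le_of_preserves_eq:
  fixes T :: "'a :: field mat \<Rightarrow> 'a mat"
  assumes inf: "infinite (UNIV :: 'a set)" and T: "linear_mat_map n T" and k: "k < n"
    and pres: "T ` prk_set n k \<subseteq> prk_set n k"
    and A: "A \<in> carrier_mat n n" "prk A \<le> k"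
  shows "prk (T A) \<le> k"
  using A
proof (induction "k - prk A" arbitrary: A)
  case 0
  then have "A \<in> prk_set n k" by (simp add: prk_set_def)
  then show ?case using pres by (auto simp: prk_set_def)
next
  case (Suc m)
  note T' = linear_mat_mapD[OF T]
  have lt: "prk A < k" using Suc.hyps(2) by simp
  obtain i j x0 where ij: "i < n" "j < n" and raise: "\<And>x. x \<noteq> x0 \<Longrightarrow> prk (A + x \<cdot>\<^sub>m unit_mat n i j) = Suc (prk A)"
    using prk_raise[OF Suc.prems(1)] lt k by (metis less_trans)
  let ?a = "\<lambda>r s. T A $$ (r, s)" and ?b = "\<lambda>r s. T (unit_mat n i j) $$ (r, s)"
  have carr: "T A \<in> carrier_mat n n" "T (unit_mat n i j) \<in> carrier_mat n n" using Suc.prems T' by auto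
  have v: "vanish n k (\<lambda>r s. ?a r s + x * ?b r s)" if "x \<noteq> x0" for x
  proof -
    let ?B = "A + x \<cdot>\<^sub>m unit_mat n i j"
    have B: "?B \<in> carrier_mat n n" using Suc.prems by simp
    have "prk (T ?B) \<le> k" using raise[OF that] Suc.hyps(2) lt B by (intro Suc.hyps(1)) auto
    then have "vanish n k (\<lambda>r s. T ?B $$ (r, s))" using prk_le_iff_vanish[OF T'(1)[OF B]] by simp
    moreover have "T ?B = T A + x \<cdot>\<^sub>m T (unit_mat n i j)" using Suc.prems by (simp add: T')
    ultimately show ?thesis
      using carr by (subst vanish_cong[of _ _ "\<lambda>r s. T ?B $$ (r, s)"]) auto
  qed
  have "vanish n k ?a"
    unfolding vanish_def
  proof (intro allI impI)
    fix I J assume IJ: "I \<subseteq> {0..<n}" "J \<subseteq> {0..<n}" "card I = Suc k" "card J = Suc k"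
    obtain p where p: "\<And>y. poly p y = per (\<lambda>r s. ?a r s + y * ?b r s) I J" using per_line_poly[of ?a ?b I J] by blast
    have "p = 0"
      using v IJ by (intro poly_zero_if_cofinite_roots[OF inf, of "{x0}"]) (auto simp: p vanish_def)
    then show "per ?a I J = 0" using p[of 0] by simp
  qed
  then show ?case using prk_le_iff_vanish[OF carr(1)] by simp
qed

text \<open>Derivatives of the larger subpermanents at \<open>T A\<close> vanish along the images of
  all matrix units, which span every direction by surjectivity; along a unit such a derivative is a
  smaller subpermanent.\<close>

lemma preserves_le_pred:
  fixes T :: "'a :: field mat \<Rightarrow> 'a mat"
  assumes inf: "infinite (UNIV :: 'a set)" and T: "linear_mat_map n T" and k: "Suc k < n"
    and surj: "T ` carrier_mat n n = carrier_mat n n"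
    and pres: "\<And>A. A \<in> carrier_mat n n \<Longrightarrow> prk A \<le> Suc k \<Longrightarrow> prk (T A) \<le> Suc k"
    and A: "A \<in> carrier_mat n n" "prk A \<le> k"
  shows "prk (T A) \<le> k"
proof -
  note T' = linear_mat_mapD[OF T]
  let ?a = "\<lambda>r s. T A $$ (r, s)"
  have "vanish n k ?a"
    unfolding vanish_def
  proof (intro allI impI)
    fix I J assume IJ: "I \<subseteq> {0..<n}" "J \<subseteq> {0..<n}" "card I = Suc k" "card J = Suc k"
    have fin: "finite I" "finite J" using IJ by (auto intro: finite_subset)
    \<comment> \<open>As \<open>k + 1 < n\<close>, a row outside \<open>I\<close> and a column
      outside \<open>J\<close> remain.\<close>
    obtain i0 j0 where ij: "i0 < n" "i0 \<notin> I" "j0 < n" "j0 \<notin> J"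
      using IJ k by (metis atLeast0LessThan card_lessThan lessThan_iff nat_neq_iff subsetI subset_antisym)
    let ?I = "insert i0 I" and ?J = "insert j0 J"
    have IJ': "?I \<subseteq> {0..<n}" "?J \<subseteq> {0..<n}" "card ?I = Suc (Suc k)" "card ?J = Suc (Suc k)"
      using IJ ij fin by auto
    have D0: "dper ?a (\<lambda>r s. T (unit_mat n i j) $$ (r, s)) ?I ?J = 0" if "i < n" "j < n" for i j
    proof -
      let ?b = "\<lambda>r s. T (unit_mat n i j) $$ (r, s)"
      obtain p where p: "\<And>y. poly p y = per (\<lambda>r s. ?a r s + y * ?b r s) ?I ?J"
        "poly (pderiv p) 0 = dper ?a ?b ?I ?J" using per_line_poly[of ?a ?b ?I ?J] by blast
      have "poly p y = 0" for y
      proof -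
        let ?B = "A + y \<cdot>\<^sub>m unit_mat n i j"
        have B: "?B \<in> carrier_mat n n" using A by simp
        have "vanish n (Suc k) (\<lambda>r s. ?B $$ (r, s))"
          using A prk_le_iff_vanish[OF A(1)] vanish_add_unit[of n k "\<lambda>r s. A $$ (r, s)" y i j]
          by (simp add: vanish_add_unit_mat[OF A(1)])
        then have "vanish n (Suc k) (\<lambda>r s. T ?B $$ (r, s))"
          using pres[OF B] prk_le_iff_vanish[OF B] prk_le_iff_vanish[OF T'(1)[OF B]] by simp
        moreover have "T ?B = T A + y \<cdot>\<^sub>m T (unit_mat n i j)" using A by (simp add: T')
        ultimately have "vanish n (Suc k) (\<lambda>r s. ?a r s + y * ?b r s)"
          using T'(1)[OF A(1)] T'(1)[OF unit_mat_carrier, of i j]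
          by (subst vanish_cong[of _ _ "\<lambda>r s. T ?B $$ (r, s)"]) auto
        then show ?thesis using IJ' unfolding p vanish_def by blast
      qed
      then have "p = 0" by (intro poly_zero_if_cofinite_roots[OF inf, of "{}"]) auto
      then show ?thesis using p(2) by simp
    qed
    \<comment> \<open>The derivative in the direction \<open>T C\<close> is the subpermanent on
      \<open>I\<close> and \<open>J\<close>.\<close>
    obtain C where C: "C \<in> carrier_mat n n" "T C = unit_mat n i0 j0"
      using surj unit_mat_carrier by (metis imageE)
    have "C = mat n n (\<lambda>(i, j). C $$ (i, j))" using C by (intro eq_matI) auto
    then have TC: "T C $$ (r, s) = (\<Sum>i<n. \<Sum>j<n. C $$ (i, j) * T (unit_mat n i j) $$ (r, s))"
      if "r < n" "s < n" for r s
      using linear_mat_map_expand[OF T that, of "\<lambda>i j. C $$ (i, j)"] by simp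
    have "per ?a I J = per ?a (?I - {i0}) (?J - {j0})" using ij by simp
    also have "\<dots> = dper ?a (unit_fun i0 j0) ?I ?J" using fin by (simp add: dper_unit del: Diff_insert0)
    also have "\<dots> = dper ?a (\<lambda>r s. \<Sum>i<n. \<Sum>j<n. C $$ (i, j) * T (unit_mat n i j) $$ (r, s)) ?I ?J"
    proof (rule dper_cong)
      fix r s assume "r \<in> ?I" "s \<in> ?J"
      then have "r < n" "s < n" using IJ'(1,2) by auto
      then show "unit_fun i0 j0 r s = (\<Sum>i<n. \<Sum>j<n. C $$ (i, j) * T (unit_mat n i j) $$ (r, s))"
        using TC[of r s] C(2) by (simp add: unit_mat_def)
    qed
    also have "\<dots> = (\<Sum>i<n. \<Sum>j<n. C $$ (i, j) * dper ?a (\<lambda>r s. T (unit_mat n i j) $$ (r, s)) ?I ?J)"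
      by (simp add: dper_sum dper_scale)
    also have "\<dots> = 0" using D0 by simp
    finally show "per ?a I J = 0" .
  qed
  then show ?thesis using prk_le_iff_vanish[OF T'(1)[OF A(1)]] by simp
qed

lemma preserves_le_1:
  fixes T :: "'a :: field mat \<Rightarrow> 'a mat"
  assumes inf: "infinite (UNIV :: 'a set)" and T: "linear_mat_map n T"
    and surj: "T ` carrier_mat n n = carrier_mat n n"
    and "1 \<le> k" "k < n"
    and "\<And>A. A \<in> carrier_mat n n \<Longrightarrow> prk A \<le> k \<Longrightarrow> prk (T A) \<le> k"
    and "A \<in> carrier_mat n n" "prk A \<le> 1"
  shows "prk (T A) \<le> 1"
  using assms(4-)
proof (induction k arbitrary: A rule: dec_induct)
  case (step m)
  show ?case
    using step.prems preserves_le_pred[OF inf T step.prems(1) surj step.prems(2)]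
    by (intro step.IH) auto
qed auto

section \<open>Semimonomial maps\<close>

text \<open>The left permutation matrix reads the row at the inverse of \<open>\<sigma>1\<close>.
  The right one reads column \<open>\<sigma>2 s\<close>, because \<open>s\<close> is the inverse
  image of \<open>l\<close> exactly if \<open>l = \<sigma>2 s\<close>.\<close>

lemma semimonomial_entry:
  assumes A: "A \<in> carrier_mat n n" and D: "D1 \<in> carrier_mat n n" "diagonal_mat D1" "D2 \<in> carrier_mat n n" "diagonal_mat D2"
    and \<sigma>: "\<sigma>1 permutes {0..<n}" "\<sigma>2 permutes {0..<n}" and rs: "r < n" "s < n"
  shows "(D1 * perm_matrix n \<sigma>1 * A * perm_matrix n \<sigma>2 * D2) $$ (r, s) =
    D1 $$ (r, r) * D2 $$ (s, s) * (A $$ (inv_into UNIV \<sigma>1 r, \<sigma>2 s) :: 'a :: field)"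
proof -
  have P: "perm_matrix n \<sigma> \<in> carrier_mat n n" for \<sigma> by (simp add: perm_matrix_def)
  have inv_lt: "inv_into UNIV \<sigma>1 r < n"
    using permutes_in_image[OF permutes_inv[OF \<sigma>(1)], of r] rs by simp
  have \<sigma>_lt: "\<sigma>2 s < n" using permutes_in_image[OF \<sigma>(2), of s] rs by simp
  have 1: "(D1 * X) $$ (i, j) = D1 $$ (i, i) * X $$ (i, j)" if "X \<in> carrier_mat n n" "i < n" "j < n" for X i j
  proof -
    have "(D1 * X) $$ (i, j) = (\<Sum>l = 0..<n. D1 $$ (i, l) * X $$ (l, j))"
      using that D by (simp add: scalar_prod_def)
    also have "\<dots> = (\<Sum>l = 0..<n. if l = i then D1 $$ (i, i) * X $$ (i, j) else 0)"
      using that D by (intro sum.cong) (auto simp: diagonal_mat_def)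
    finally show ?thesis using that by simp
  qed
  have 2: "(X * D2) $$ (i, j) = X $$ (i, j) * D2 $$ (j, j)" if "X \<in> carrier_mat n n" "i < n" "j < n" for X i j
  proof -
    have "(X * D2) $$ (i, j) = (\<Sum>l = 0..<n. X $$ (i, l) * D2 $$ (l, j))"
      using that D by (simp add: scalar_prod_def)
    also have "\<dots> = (\<Sum>l = 0..<n. if l = j then X $$ (i, j) * D2 $$ (j, j) else 0)"
      using that D by (intro sum.cong) (auto simp: diagonal_mat_def)
    finally show ?thesis using that by simp
  qed
  have 3: "(perm_matrix n \<sigma>1 * A) $$ (r, j) = A $$ (inv_into UNIV \<sigma>1 r, j)" if "j < n" for j
  proof -
    have "(perm_matrix n \<sigma>1 * A) $$ (r, j) =
        (\<Sum>l = 0..<n. (if l = inv_into UNIV \<sigma>1 r then 1 else 0) * A $$ (l, j))"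
      using that A rs by (simp add: scalar_prod_def perm_matrix_def)
    also have "\<dots> = (\<Sum>l = 0..<n. if l = inv_into UNIV \<sigma>1 r then A $$ (inv_into UNIV \<sigma>1 r, j) else 0)"
      by (intro sum.cong) auto
    finally show ?thesis using inv_lt by simp
  qed
  have 4: "(X * perm_matrix n \<sigma>2) $$ (r, s) = X $$ (r, \<sigma>2 s)" if X: "X \<in> carrier_mat n n" for X :: "'a mat"
  proof -
    have "(X * perm_matrix n \<sigma>2) $$ (r, s) =
        (\<Sum>l = 0..<n. X $$ (r, l) * (if s = inv_into UNIV \<sigma>2 l then 1 else 0))"
      using X rs by (simp add: scalar_prod_def perm_matrix_def)
    also have "\<dots> = (\<Sum>l = 0..<n. if l = \<sigma>2 s then X $$ (r, \<sigma>2 s) else 0)"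
      using permutes_inv_eq[OF \<sigma>(2)] by (intro sum.cong refl) (auto simp: eq_commute[of s])
    finally show ?thesis using \<sigma>_lt by simp
  qed
  have "(D1 * perm_matrix n \<sigma>1 * A * perm_matrix n \<sigma>2 * D2) $$ (r, s) =
      (D1 * (perm_matrix n \<sigma>1 * A) * perm_matrix n \<sigma>2 * D2) $$ (r, s)"
    using assoc_mult_mat[OF D(1) P A] by simp
  also have "\<dots> = (D1 * (perm_matrix n \<sigma>1 * A)) $$ (r, \<sigma>2 s) * D2 $$ (s, s)"
  proof -
    have X: "D1 * (perm_matrix n \<sigma>1 * A) \<in> carrier_mat n n"
      using A D P by (auto intro!: mult_carrier_mat)
    show ?thesis
      unfolding 2[OF mult_carrier_mat[OF X P] rs] 4[OF X] ..
  qed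
  also have "\<dots> = D1 $$ (r, r) * D2 $$ (s, s) * A $$ (inv_into UNIV \<sigma>1 r, \<sigma>2 s)"
    using A P rs \<sigma>_lt by (subst 1) (auto intro!: mult_carrier_mat simp: 3)
  finally show ?thesis .
qed

text \<open>Up to a nonzero factor each subpermanent is one of \<open>a\<close> on permuted index
  sets, and permutations act bijectively on the index sets of each size.\<close>

lemma vanish_semimonomial:
  fixes a :: "nat \<Rightarrow> nat \<Rightarrow> 'a :: field"
  assumes \<alpha>: "\<alpha> permutes {0..<n}" and \<beta>: "\<beta> permutes {0..<n}"
    and d: "\<forall>r<n. d r \<noteq> 0" and e: "\<forall>s<n. e s \<noteq> 0"
  shows "vanish n k (\<lambda>r s. d r * e s * a (\<alpha> r) (\<beta> s)) \<longleftrightarrow> vanish n k a"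
proof -
  have per: "per (\<lambda>r s. d r * e s * a (\<alpha> r) (\<beta> s)) I J = 0 \<longleftrightarrow> per a (\<alpha> ` I) (\<beta> ` J) = 0"
    if IJ: "I \<subseteq> {0..<n}" "J \<subseteq> {0..<n}" for I J
  proof -
    have fin: "finite I" "finite J" using IJ by (auto intro: finite_subset)
    have "per (\<lambda>r s. d r * e s * a (\<alpha> r) (\<beta> s)) I J = prod d I * prod e J * per a (\<alpha> ` I) (\<beta> ` J)"
      using per_reindex[OF permutes_inj_on[OF \<alpha>] permutes_inj_on[OF \<beta>], of a I J] fin
      by (simp add: per_scale)
    moreover have "prod d I \<noteq> 0" "prod e J \<noteq> 0" using d e IJ fin by (auto simp: subset_iff)
    ultimately show ?thesis by simp
  qed
  have im: "\<pi> ` I \<subseteq> {0..<n}" "card (\<pi> ` I) = card I" if "\<pi> permutes {0..<n}" "I \<subseteq> {0..<n}" for \<pi> I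
    using that permutes_image[OF that(1)] by (auto simp: card_image permutes_inj_on)
  have pre: "\<exists>I'\<subseteq>{0..<n}. card I' = card I \<and> I = \<pi> ` I'" if \<pi>: "\<pi> permutes {0..<n}" "I \<subseteq> {0..<n}" for \<pi> I
    using im[OF permutes_inv[OF \<pi>(1)] \<pi>(2)]
    by (intro exI[of _ "inv_into UNIV \<pi> ` I"])
      (simp add: image_image permutes_inverses[OF \<pi>(1)])
  show ?thesis
  proof
    assume v: "vanish n k (\<lambda>r s. d r * e s * a (\<alpha> r) (\<beta> s))"
    show "vanish n k a"
      unfolding vanish_def
    proof (intro allI impI)
      fix I J assume IJ: "I \<subseteq> {0..<n}" "J \<subseteq> {0..<n}" "card I = Suc k" "card J = Suc k"
      obtain I' J' where *: "I' \<subseteq> {0..<n}" "card I' = card I" "I = \<alpha> ` I'"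
        "J' \<subseteq> {0..<n}" "card J' = card J" "J = \<beta> ` J'"
        using pre[OF \<alpha> IJ(1)] pre[OF \<beta> IJ(2)] by blast
      have "per (\<lambda>r s. d r * e s * a (\<alpha> r) (\<beta> s)) I' J' = 0"
        using v[unfolded vanish_def, rule_format, OF *(1,4)] *(2,5) IJ(3,4) by simp
      then show "per a I J = 0" using per[OF *(1,4)] *(3,6) by simp
    qed
  next
    assume v: "vanish n k a"
    show "vanish n k (\<lambda>r s. d r * e s * a (\<alpha> r) (\<beta> s))"
      unfolding vanish_def
    proof (intro allI impI)
      fix I J assume IJ: "I \<subseteq> {0..<n}" "J \<subseteq> {0..<n}" "card I = Suc k" "card J = Suc k"
      have "per a (\<alpha> ` I) (\<beta> ` J) = 0"
        using v[unfolded vanish_def, rule_format, OF im(1)[OF \<alpha> IJ(1)] im(1)[OF \<beta> IJ(2)]]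
          im(2)[OF \<alpha> IJ(1)] im(2)[OF \<beta> IJ(2)] IJ(3,4) by simp
      then show "per (\<lambda>r s. d r * e s * a (\<alpha> r) (\<beta> s)) I J = 0" using per[OF IJ(1,2)] by simp
    qed
  qed
qed

lemma vanish_transpose: "vanish n k (\<lambda>i j. a j i) \<longleftrightarrow> vanish n k a"
  unfolding vanish_def per_transpose[of a] by blast

text \<open>A natural number is determined by its upper bounds.\<close>

lemma prk_eqI:
  assumes "A \<in> carrier_mat n n" "B \<in> carrier_mat n n"
    and "\<And>k. vanish n k (\<lambda>i j. A $$ (i, j)) \<longleftrightarrow> vanish n k (\<lambda>i j. B $$ (i, j))"
  shows "prk A = prk B"
  using assms prk_le_iff_vanish by (metis le_antisym order_refl)

lemma prk_transpose:
  assumes "A \<in> carrier_mat n n"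
  shows "prk (A\<^sup>T) = prk A"
proof (rule prk_eqI[of _ n])
  fix k
  have "vanish n k (\<lambda>i j. A\<^sup>T $$ (i, j)) \<longleftrightarrow> vanish n k (\<lambda>i j. A $$ (j, i))"
    using assms by (intro vanish_cong) auto
  then show "vanish n k (\<lambda>i j. A\<^sup>T $$ (i, j)) \<longleftrightarrow> vanish n k (\<lambda>i j. A $$ (i, j))"
    using vanish_transpose[of n k "\<lambda>i j. A $$ (i, j)"] by simp
qed (use assms in auto)

lemma prk_semimonomial:
  fixes A :: "'a :: field mat"
  assumes A: "A \<in> carrier_mat n n"
    and D: "D1 \<in> carrier_mat n n" "diagonal_mat D1" "D2 \<in> carrier_mat n n" "diagonal_mat D2"
    and nz: "\<forall>i<n. D1 $$ (i, i) \<noteq> 0" "\<forall>i<n. D2 $$ (i, i) \<noteq> 0"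
    and \<sigma>: "\<sigma>1 permutes {0..<n}" "\<sigma>2 permutes {0..<n}"
  shows "prk (D1 * perm_matrix n \<sigma>1 * A * perm_matrix n \<sigma>2 * D2) = prk A" (is "prk ?B = _")
proof (rule prk_eqI[of _ n])
  show "?B \<in> carrier_mat n n" using A D by (auto simp: perm_matrix_def)
  fix k
  have "vanish n k (\<lambda>i j. ?B $$ (i, j)) \<longleftrightarrow>
      vanish n k (\<lambda>r s. D1 $$ (r, r) * D2 $$ (s, s) * A $$ (inv_into UNIV \<sigma>1 r, \<sigma>2 s))"
    by (intro vanish_cong semimonomial_entry[OF A D \<sigma>])
  also have "\<dots> \<longleftrightarrow> vanish n k (\<lambda>i j. A $$ (i, j))"
    using vanish_semimonomial[OF permutes_inv[OF \<sigma>(1)] \<sigma>(2) nz, of k "\<lambda>i j. A $$ (i, j)"] by simp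
  finally show "vanish n k (\<lambda>i j. ?B $$ (i, j)) \<longleftrightarrow> vanish n k (\<lambda>i j. A $$ (i, j))" .
qed (rule A)

section \<open>From preservation of rank at most 1 to the matrix form of the map\<close>

lemma semimonomial_of_preserves_le_1:
  fixes T :: "'a :: field mat \<Rightarrow> 'a mat"
  assumes inf: "infinite (UNIV :: 'a set)" and two: "(2 :: 'a) \<noteq> 0" and n: "3 \<le> n"
    and T: "linear_mat_map n T" and bij: "bij_betw T (carrier_mat n n) (carrier_mat n n)"
    and pres: "\<And>A. A \<in> carrier_mat n n \<Longrightarrow> prk A \<le> 1 \<Longrightarrow> prk (T A) \<le> 1"
  shows "\<exists>\<sigma>1 \<sigma>2 D1 D2.
       \<sigma>1 permutes {0..<n} \<and> \<sigma>2 permutes {0..<n} \<and>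
       D1 \<in> carrier_mat n n \<and> diagonal_mat D1 \<and> (\<forall>i<n. D1 $$ (i, i) \<noteq> 0) \<and>
       D2 \<in> carrier_mat n n \<and> diagonal_mat D2 \<and> (\<forall>i<n. D2 $$ (i, i) \<noteq> 0) \<and>
       ((\<forall>A \<in> carrier_mat n n. T A = D1 * perm_matrix n \<sigma>1 * A * perm_matrix n \<sigma>2 * D2) \<or>
        (\<forall>A \<in> carrier_mat n n. T A = D1 * perm_matrix n \<sigma>1 * A\<^sup>T * perm_matrix n \<sigma>2 * D2))"
proof -
  note T' = linear_mat_mapD[OF T]
  define M where "M = (\<lambda>i j r s. T (unit_mat n i j) $$ (r, s))"
  have L: "T (mat n n (\<lambda>(i, j). a i j)) $$ (r, s) = (\<Sum>i<n. \<Sum>j<n. a i j * M i j r s)"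
    if "r < n" "s < n" for a r s
    using linear_mat_map_expand[OF T that] by (simp add: M_def)
  interpret prk1_map n M
  proof
    fix a :: "nat \<Rightarrow> nat \<Rightarrow> 'a" assume a: "prk1 n a"
    let ?A = "mat n n (\<lambda>(i, j). a i j)"
    have A: "?A \<in> carrier_mat n n" by simp
    have "vanish n 1 (\<lambda>i j. ?A $$ (i, j))"
      using a by (subst vanish_cong[of _ _ a]) (auto simp: vanish_1_iff_prk1[symmetric])
    then have "vanish n 1 (\<lambda>r s. T ?A $$ (r, s))"
      using pres[OF A] prk_le_iff_vanish[OF A] prk_le_iff_vanish[OF T'(1)[OF A]] by blast
    then show "prk1 n (\<lambda>r s. \<Sum>i<n. \<Sum>j<n. a i j * M i j r s)"
      unfolding vanish_1_iff_prk1[symmetric]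
      by (subst vanish_cong[of _ _ "\<lambda>r s. T ?A $$ (r, s)"]) (auto simp: L)
  next
    fix a i j assume z: "\<And>r s. r < n \<Longrightarrow> s < n \<Longrightarrow> (\<Sum>i<n. \<Sum>j<n. a i j * M i j r s) = 0"
      and ij: "i < n" "j < n"
    let ?A = "mat n n (\<lambda>(i, j). a i j)"
    have "T ?A = T (0\<^sub>m n n)" unfolding linear_mat_map_zero[OF T]
      using T'(1)[of ?A] by (intro eq_matI) (auto simp: L z)
    then have "?A = 0\<^sub>m n n"
      using bij by (auto simp: bij_betw_def inj_on_def)
    then have "?A $$ (i, j) = 0\<^sub>m n n $$ (i, j)" by simp
    then show "a i j = 0" using ij by simp
  next
    fix r s assume rs: "r < n" "s < n"
    \<comment> \<open>The image of \<open>C\<close> has entry 1 at \<open>(r, s)\<close>, so some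
      matrix unit must contribute there.\<close>
    obtain C where C: "C \<in> carrier_mat n n" "T C = unit_mat n r s"
      using bij unit_mat_carrier unfolding bij_betw_def by (metis imageE)
    have "C = mat n n (\<lambda>(i, j). C $$ (i, j))" using C by (intro eq_matI) auto
    then have "T C $$ (r, s) = (\<Sum>i<n. \<Sum>j<n. C $$ (i, j) * M i j r s)"
      using L[OF rs, of "\<lambda>i j. C $$ (i, j)"] by simp
    then have "(\<Sum>i<n. \<Sum>j<n. C $$ (i, j) * M i j r s) = 1"
      using C rs by (simp add: unit_mat_def unit_fun_def)
    then show "\<exists>i<n. \<exists>j<n. M i j r s \<noteq> 0"
      by (metis (no_types, lifting) lessThan_iff mult_zero_right sum.neutral zero_neq_one)
  qed (use inf two n in auto)
  obtain \<alpha> \<beta> d e where ab: "\<alpha> permutes {0..<n}" "\<beta> permutes {0..<n}"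
    and de: "\<forall>r<n. d r \<noteq> 0" "\<forall>s<n. e s \<noteq> 0"
    and st: "(\<forall>a. \<forall>r<n. \<forall>s<n. (\<Sum>i<n. \<Sum>j<n. a i j * M i j r s) = d r * e s * a (\<alpha> r) (\<beta> s)) \<or>
     (\<forall>a. \<forall>r<n. \<forall>s<n. (\<Sum>i<n. \<Sum>j<n. a i j * M i j r s) = d r * e s * a (\<beta> s) (\<alpha> r))"
    using semimonomial by blast
  define D1 where "D1 = mat n n (\<lambda>(i, j). if i = j then d i else 0)"
  define D2 where "D2 = mat n n (\<lambda>(i, j). if i = j then e i else 0)"
  \<comment> \<open>A permutation matrix on the left reads rows through its inverse, so the inverse
    of \<open>\<alpha>\<close> is needed there, while \<open>\<beta>\<close> itself serves on the
    right.\<close>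
  define \<sigma> where "\<sigma> = inv_into UNIV \<alpha>"
  have \<sigma>: "\<sigma> permutes {0..<n}" unfolding \<sigma>_def by (rule permutes_inv[OF ab(1)])
  have inv\<sigma>: "inv_into UNIV \<sigma> = \<alpha>" unfolding \<sigma>_def by (rule inv_inv_eq[OF permutes_bij[OF ab(1)]])
  have D: "D1 \<in> carrier_mat n n" "diagonal_mat D1" "D2 \<in> carrier_mat n n" "diagonal_mat D2"
    by (auto simp: D1_def D2_def diagonal_mat_def)
  have TA: "T A $$ (r, s) = (\<Sum>i<n. \<Sum>j<n. A $$ (i, j) * M i j r s)"
    if "A \<in> carrier_mat n n" "r < n" "s < n" for A r s
  proof -
    have "A = mat n n (\<lambda>(i, j). A $$ (i, j))" using that by (intro eq_matI) auto
    then show ?thesis using L[OF that(2,3), of "\<lambda>i j. A $$ (i, j)"] by simp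
  qed
  have lt: "\<alpha> r < n" "\<beta> r < n" if "r < n" for r
    using permutes_in_image[OF ab(1), of r] permutes_in_image[OF ab(2), of r] that by auto
  \<comment> \<open>\<open>B\<close> will be \<open>A\<close> or its transpose.\<close>
  have eqI: "T A = D1 * perm_matrix n \<sigma> * B * perm_matrix n \<beta> * D2"
    if A: "A \<in> carrier_mat n n" and B: "B \<in> carrier_mat n n"
      and eq: "\<And>r s. r < n \<Longrightarrow> s < n \<Longrightarrow> T A $$ (r, s) = d r * e s * B $$ (\<alpha> r, \<beta> s)" for A B
  proof (rule eq_matI)
    fix r s assume "r < dim_row (D1 * perm_matrix n \<sigma> * B * perm_matrix n \<beta> * D2)"
      "s < dim_col (D1 * perm_matrix n \<sigma> * B * perm_matrix n \<beta> * D2)"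
    then have rs: "r < n" "s < n" using D by auto
    show "T A $$ (r, s) = (D1 * perm_matrix n \<sigma> * B * perm_matrix n \<beta> * D2) $$ (r, s)"
      unfolding semimonomial_entry[OF B D \<sigma> ab(2) rs] inv\<sigma>
      using rs by (simp add: eq D1_def D2_def)
  qed (use T'(1)[OF A] D in auto)
  have nz: "\<forall>i<n. D1 $$ (i, i) \<noteq> 0" "\<forall>i<n. D2 $$ (i, i) \<noteq> 0"
    using de by (auto simp: D1_def D2_def)
  have "(\<forall>A \<in> carrier_mat n n. T A = D1 * perm_matrix n \<sigma> * A * perm_matrix n \<beta> * D2) \<or>
        (\<forall>A \<in> carrier_mat n n. T A = D1 * perm_matrix n \<sigma> * A\<^sup>T * perm_matrix n \<beta> * D2)"
    using st
  proof
    assume "\<forall>a. \<forall>r<n. \<forall>s<n. (\<Sum>i<n. \<Sum>j<n. a i j * M i j r s) = d r * e s * a (\<alpha> r) (\<beta> s)"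
    then have "T A = D1 * perm_matrix n \<sigma> * A * perm_matrix n \<beta> * D2" if "A \<in> carrier_mat n n" for A
      using that by (intro eqI) (auto simp: TA)
    then show ?thesis by blast
  next
    assume "\<forall>a. \<forall>r<n. \<forall>s<n. (\<Sum>i<n. \<Sum>j<n. a i j * M i j r s) = d r * e s * a (\<beta> s) (\<alpha> r)"
    then have "T A = D1 * perm_matrix n \<sigma> * A\<^sup>T * perm_matrix n \<beta> * D2" if "A \<in> carrier_mat n n" for A
      using that lt by (intro eqI) (auto simp: TA)
    then show ?thesis by blast
  qed
  then show ?thesis using \<sigma> ab(2) D nz by blast
qed

theorem theorem1p4:
  fixes T :: "'a :: field mat \<Rightarrow> 'a mat" and n k :: nat
  assumes "infinite (UNIV :: 'a set)" and "CHAR('a) \<noteq> 2"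
    and "3 \<le> n" and "1 \<le> k" and "k \<le> n - 1"
    and "linear_mat_map n T"
    and "bij_betw T (carrier_mat n n) (carrier_mat n n)"
  shows "T ` prk_set n k \<subseteq> prk_set n k \<longleftrightarrow>
    (\<exists>\<sigma>1 \<sigma>2 D1 D2.
       \<sigma>1 permutes {0..<n} \<and> \<sigma>2 permutes {0..<n} \<and>
       D1 \<in> carrier_mat n n \<and> diagonal_mat D1 \<and> (\<forall>i<n. D1 $$ (i, i) \<noteq> 0) \<and>
       D2 \<in> carrier_mat n n \<and> diagonal_mat D2 \<and> (\<forall>i<n. D2 $$ (i, i) \<noteq> 0) \<and>
       ((\<forall>A \<in> carrier_mat n n. T A = D1 * perm_matrix n \<sigma>1 * A * perm_matrix n \<sigma>2 * D2) \<or>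
        (\<forall>A \<in> carrier_mat n n. T A = D1 * perm_matrix n \<sigma>1 * A\<^sup>T * perm_matrix n \<sigma>2 * D2)))"
    (is "?lhs \<longleftrightarrow> ?rhs")
proof
  assume ?lhs
  have k: "k < n" using assms(3,5) by simp
  have surj: "T ` carrier_mat n n = carrier_mat n n" using assms(7) by (simp add: bij_betw_def)
  have "(2 :: 'a) \<noteq> 0"
  proof
    assume "(2 :: 'a) = 0"
    \<comment> \<open>A field does not have characteristic 1, so a characteristic dividing 2 would
      be 2.\<close>
    then have "CHAR('a) dvd 2" using of_nat_eq_0_iff_char_dvd[of 2, where 'a = 'a] by simp
    then have "CHAR('a) = 1 \<or> CHAR('a) = 2"
      using two_is_prime_nat by (auto simp: prime_nat_iff)
    then show False using assms(2) CHAR_not_1' by auto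
  qed
  \<comment> \<open>Preserving rank equal to \<open>k\<close> gives the bound \<open>k\<close>,
    which is then lowered to 1.\<close>
  moreover have "prk (T A) \<le> 1" if "A \<in> carrier_mat n n" "prk A \<le> 1" for A
    using preserves_le_1[OF assms(1,6) surj assms(4) k] that
      preserves_le_of_preserves_eq[OF assms(1,6) k \<open>?lhs\<close>] by blast
  ultimately show ?rhs
    using semimonomial_of_preserves_le_1[OF assms(1) _ assms(3,6,7)] by blast
next
  assume ?rhs
  then obtain \<sigma>1 \<sigma>2 D1 D2 where \<sigma>: "\<sigma>1 permutes {0..<n}" "\<sigma>2 permutes {0..<n}"
    and D: "D1 \<in> carrier_mat n n" "diagonal_mat D1" "D2 \<in> carrier_mat n n" "diagonal_mat D2"
    and nz: "\<forall>i<n. D1 $$ (i, i) \<noteq> 0" "\<forall>i<n. D2 $$ (i, i) \<noteq> 0"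
    and T: "(\<forall>A \<in> carrier_mat n n. T A = D1 * perm_matrix n \<sigma>1 * A * perm_matrix n \<sigma>2 * D2) \<or>
        (\<forall>A \<in> carrier_mat n n. T A = D1 * perm_matrix n \<sigma>1 * A\<^sup>T * perm_matrix n \<sigma>2 * D2)"
    by blast
  \<comment> \<open>Maps of this form keep the permanental rank of every matrix, whatever its
    value.\<close>
  have "prk (T A) = prk A" if A: "A \<in> carrier_mat n n" for A
    using T prk_semimonomial[OF A D nz \<sigma>]
      prk_semimonomial[OF transpose_carrier_mat[THEN iffD2, OF A] D nz \<sigma>] prk_transpose[OF A] A
    by auto
  then show ?lhs using linear_mat_mapD(1)[OF assms(6)] by (auto simp: prk_set_def)
qed

end
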